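(* Fix $\epsilon\in(0,1)$ and a positive integer $\ell\le d$. Let $\mathbf{P}=\sqrt{d/\ell}\;\mathbf{Q}\,\mathbf{I}_{d\times\ell}\in\mathbb{R}^{d\times\ell}$, where $\mathbf{Q}$ is a Haar-distributed random $d\times d$ orthogonal matrix and $\mathbf{I}_{d\times\ell}$ consists of the first $\ell$ columns of the $d\times d$ identity matrix. Then for any fixed vector $\mathbf{v}\in\mathbb{R}^d$, the probability $\delta$ of a successful embedding, i.e. the probability of the event $\|\mathbf{P}^\top\mathbf{v}\|^2\ge(1-\epsilon)\|\mathbf{v}\|^2$, is given by $$\delta=1-I_{(1-\epsilon)\ell/d}\big(\ell/2,(d-\ell)/2\big)=\mathbb{P}\big(X\ge(1-\epsilon)\ell/d\big),$$ where $I_p(\alpha,\beta)$ is the regularized incomplete Beta function and $X\sim\mathrm{Beta}\big(\ell/2,(d-\ell)/2\big)$.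
   Context: $\|\cdot\|$ is the Euclidean norm. $\mathbf{Q}$ is realized as the orthogonal factor in the QR decomposition $\mathbf{Z}=\mathbf{Q}\mathbf{R}$, with $\mathbf{R}_{ii}>0$, of a $d\times d$ matrix $\mathbf{Z}$ with i.i.d. $\mathcal{N}(0,1)$ entries. $I_p(\alpha,\beta)$ is the CDF at $p$ of the $\mathrm{Beta}(\alpha,\beta)$ distribution. In the degenerate case $\ell=d$, $\mathrm{Beta}(d/2,0)$ is understood as the point mass at $1$, so that $\delta=1$.
   Formalization: The fixed vector v is assumed to be nonzero: for v = 0 and ℓ < d the event always holds, so δ = 1, while 1 − I_{(1−ε)ℓ/d}(ℓ/2,(d−ℓ)/2) is strictly less than 1. *)

theory Defs
  imports "HOL-Probability.Probability"
begin

text \<open>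
  The dimensions \<open>d\<close> and \<open>\<ell>\<close> are the cardinalities of finite linearly ordered index types;
  \<open>pos i\<close> is the 0-based position of the index \<open>i\<close>, so that indices of different types
  can be matched.
\<close>

definition pos :: "'n::{finite,linorder} \<Rightarrow> nat" where
  "pos i = card {k. k < i}"

definition first_columns :: "real ^ 'l::{finite,linorder} ^ 'd::{finite,linorder}" where
  "first_columns = (\<chi> i j. if pos i = pos j then 1 else 0)"

definition embedding_matrix ::
    "real ^ 'd::{finite,linorder} ^ 'd::{finite,linorder} \<Rightarrow>
     real ^ 'l::{finite,linorder} ^ 'd::{finite,linorder}" where
  "embedding_matrix Q = sqrt (real CARD('d) / real CARD('l)) *\<^sub>R (Q ** first_columns)"

text \<open>
  A random matrix is Haar distributed on the orthogonal group if it is almost surely orthogonal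
  and its law is invariant under left translations. The group being compact, these conditions
  determine the law (the normalized Haar measure), which is then also invariant under right
  translations.
\<close>

definition haar_orthogonal :: "'a measure \<Rightarrow> ('a \<Rightarrow> real ^ 'd ^ 'd) \<Rightarrow> bool" where
  "haar_orthogonal M Q \<longleftrightarrow>
     Q \<in> borel_measurable M \<and>
     (AE \<omega> in M. orthogonal_matrix (Q \<omega>)) \<and>
     (\<forall>U. orthogonal_matrix U \<longrightarrow> distr M borel (\<lambda>\<omega>. U ** Q \<omega>) = distr M borel Q)"

definition iid_std_normal_matrix :: "'a measure \<Rightarrow> ('a \<Rightarrow> real ^ 'd ^ 'd) \<Rightarrow> bool" where
  "iid_std_normal_matrix M Z \<longleftrightarrow>
     prob_space.indep_vars M (\<lambda>_. borel) (\<lambda>(i, j) \<omega>. Z \<omega> $ i $ j) UNIV \<and>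
     (\<forall>i j. distributed M lborel (\<lambda>\<omega>. Z \<omega> $ i $ j) std_normal_density)"

definition is_QR ::
    "real ^ 'd::{finite,linorder} ^ 'd::{finite,linorder} \<Rightarrow>
     real ^ 'd::{finite,linorder} ^ 'd::{finite,linorder} \<Rightarrow>
     real ^ 'd::{finite,linorder} ^ 'd::{finite,linorder} \<Rightarrow> bool" where
  "is_QR Z Q R \<longleftrightarrow>
     Z = Q ** R \<and> orthogonal_matrix Q \<and>
     (\<forall>i j. j < i \<longrightarrow> R $ i $ j = 0) \<and> (\<forall>i. 0 < R $ i $ i)"

text \<open>
  The decomposition with positive diagonal exists (and is unique) exactly when \<open>Z\<close> is
  invertible, hence it is only required almost surely.
\<close>

definition gaussian_QR_factor ::
    "'a measure \<Rightarrow> ('a \<Rightarrow> real ^ 'd::{finite,linorder} ^ 'd::{finite,linorder}) \<Rightarrow> bool" where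
  "gaussian_QR_factor M Q \<longleftrightarrow>
     Q \<in> borel_measurable M \<and>
     (\<exists>Z. iid_std_normal_matrix M Z \<and> (AE \<omega> in M. \<exists>R. is_QR (Z \<omega>) (Q \<omega>) R))"

text \<open>The Beta distribution, with the convention that \<open>Beta(a, 0)\<close> is the point mass at 1.\<close>

definition beta_distribution :: "real \<Rightarrow> real \<Rightarrow> real measure" where
  "beta_distribution a b =
     (if b = 0 then return borel 1
      else density lborel (\<lambda>x. ennreal (indicator {0<..<1} x *
             (x powr (a - 1) * (1 - x) powr (b - 1) / Beta a b))))"

definition reg_inc_beta :: "real \<Rightarrow> real \<Rightarrow> real \<Rightarrow> real" where
  "reg_inc_beta p a b = cdf (beta_distribution a b) p"

end

theory Submission
  imports Defs
begin

text \<open>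
  Up to the factor \<open>d / \<ell>\<close>, the quantity \<open>\<parallel>P\<^sup>T v\<parallel>\<^sup>2 / \<parallel>v\<parallel>\<^sup>2\<close> is the share of \<open>\<ell>\<close> coordinates in the squared
  norm of \<open>Q\<^sup>T v\<close>. Averaging over a Gaussian vector \<open>g\<close> independent of \<open>Q\<close> shows that the direction
  of \<open>Q\<^sup>T v\<close> has the same law as that of \<open>g\<close>. For \<open>g\<close> the two partial sums of squares are
  independent Gamma variables with parameters \<open>\<ell> / 2\<close> and \<open>(d - \<ell>) / 2\<close>, and \<open>A / (A + B)\<close> is then
  Beta distributed. The QR factor of a Gaussian matrix is left invariant, because \<open>U Q\<close> is the QR
  factor of \<open>U Z\<close> and \<open>U Z\<close> has the law of \<open>Z\<close>.
\<close>

subsection \<open>Rotation invariance of the standard Gaussian\<close>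

text \<open>Left invariance alone controls \<open>Q\<^sup>T v\<close>: passing from \<open>Q\<close>
  to \<open>U ** Q\<close> amounts to passing from \<open>v\<close> to \<open>U\<^sup>T v\<close>,
  so the law of \<open>Q\<^sup>T v\<close> depends on \<open>v\<close> only through its norm. A
  ratio of squared coordinates does not see the norm either, which is why the fixed \<open>v\<close>
  may be exchanged for a random Gaussian vector. This avoids both the uniqueness of Haar measure and
  the uniform measure on the sphere. Rotation invariance is needed in two spaces, for vectors
  (\<open>g\<close> to \<open>Q\<^sup>T g\<close>) and for matrices (\<open>Z\<close> to
  \<open>U ** Z\<close>); hence it is proved over an arbitrary Euclidean space. For the QR factor
  the obstacle is measurability: transporting the law of \<open>Z\<close> to that of
  \<open>Q\<close> takes a Borel map from \<open>Z\<close> to \<open>Q\<close>. It is obtained from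
  a compactness argument instead of Gram-Schmidt formulas. When \<ell> = d the second Gamma
  parameter would be 0, so this case is separated and leads to the point mass at 1.\<close>

lemma nn_integral_lborel_translate:
  fixes c :: "'a::euclidean_space"
  assumes [measurable]: "f \<in> borel_measurable borel"
  shows "(\<integral>\<^sup>+x. f (c + x) \<partial>lborel) = (\<integral>\<^sup>+x. f x \<partial>lborel)"
  by (subst (2) lborel_distr_plus[of c, symmetric], subst nn_integral_distr) auto

lemma emeasure_unit_ball_translate:
  fixes c :: "'a::euclidean_space"
  shows "(\<integral>\<^sup>+x. indicator (ball 0 1) (x - c) \<partial>lborel) = emeasure lborel (ball (0::'a) 1)"
  using nn_integral_lborel_translate[of "indicator (ball 0 1)" "-c"]
  by (simp add: borel_measurable_indicator)

text \<open>
  Integrating \<open>1\<^sub>A (T x + y) 1\<^sub>B (y)\<close> over \<open>x\<close> and \<open>y\<close>, where \<open>B\<close> is the unit ball, gives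
  \<open>vol (T\<^sup>-\<^sup>1 A) vol B\<close> in one order of integration and, since \<open>T\<close> preserves \<open>B\<close>,
  \<open>vol A vol B\<close> in the other.
\<close>

lemma lborel_distr_orthogonal_transformation:
  fixes T :: "'a::euclidean_space \<Rightarrow> 'a"
  assumes T: "orthogonal_transformation T"
  shows "distr lborel borel T = lborel"
proof (rule measure_eqI)
  show "sets (distr lborel borel T) = sets lborel" by simp
next
  fix A assume "A \<in> sets (distr lborel borel T)"
  then have [measurable]: "A \<in> sets borel" by simp
  have lin: "linear T" and surj: "surj T"
    using T by (simp_all add: orthogonal_transformation_linear orthogonal_transformation_surj)
  have [measurable]: "T \<in> borel_measurable borel"
    by (intro borel_measurable_continuous_onI linear_continuous_on linear_conv_bounded_linear[THEN iffD1] lin)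
  define B where "B = ball (0::'a) 1"
  have [measurable]: "B \<in> sets borel" by (simp add: B_def)
  let ?L = "emeasure lborel (T -` A)"
  \<comment> \<open>By surjectivity the shift \<open>y\<close> in the image is a shift
    \<open>z\<close> of the argument, which Lebesgue measure does not notice.\<close>
  have L: "?L = (\<integral>\<^sup>+x. indicator A (T x + y) \<partial>lborel)" for y
  proof -
    obtain z where z: "y = T z" using surj by (metis surjD)
    have "?L = (\<integral>\<^sup>+x. indicator A (T x) \<partial>lborel)"
      by (subst nn_integral_indicator[symmetric])
         (auto simp: indicator_def intro!: nn_integral_cong measurable_sets_borel[of T borel])
    also have "\<dots> = (\<integral>\<^sup>+x. indicator A (T (z + x)) \<partial>lborel)"
      by (rule nn_integral_lborel_translate[symmetric]) simp
    finally show ?thesis by (simp add: z linear_add[OF lin] add.commute)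
  qed
  have B: "(\<integral>\<^sup>+x. indicator B (y - T x) \<partial>lborel) = emeasure lborel B" for y
  proof -
    obtain z where z: "y = T z" using surj by (metis surjD)
    have "norm (T z - T x) = norm (x - z)" for x
      by (metis T lin linear_diff norm_minus_commute orthogonal_transformation_norm)
    then have "indicator B (y - T x) = (indicator B (x - z) :: ennreal)" for x
      by (simp add: z B_def indicator_def)
    then show ?thesis
      using emeasure_unit_ball_translate[of z] by (simp add: B_def)
  qed
  have "?L * emeasure lborel B = (\<integral>\<^sup>+y. indicator B y * ?L \<partial>lborel)"
    by (simp add: nn_integral_multc mult.commute)
  also have "\<dots> = (\<integral>\<^sup>+y. indicator B y * (\<integral>\<^sup>+x. indicator A (T x + y) \<partial>lborel) \<partial>lborel)"
    using L by simp
  also have "\<dots> = (\<integral>\<^sup>+y. (\<integral>\<^sup>+x. indicator B y * indicator A (T x + y) \<partial>lborel) \<partial>lborel)"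
    by (intro nn_integral_cong nn_integral_cmult[symmetric]) measurable
  also have "\<dots> = (\<integral>\<^sup>+x. (\<integral>\<^sup>+y. indicator B y * indicator A (T x + y) \<partial>lborel) \<partial>lborel)"
    by (rule lborel_pair.Fubini') measurable
  also have "\<dots> = (\<integral>\<^sup>+x. (\<integral>\<^sup>+y. indicator B (y - T x) * indicator A y \<partial>lborel) \<partial>lborel)"
  proof (rule nn_integral_cong)
    fix x
    show "(\<integral>\<^sup>+y. indicator B y * indicator A (T x + y) \<partial>lborel)
        = (\<integral>\<^sup>+y. indicator B (y - T x) * indicator A y \<partial>lborel)"
      using nn_integral_lborel_translate[of "\<lambda>y. indicator B (y - T x) * indicator A y" "T x"]
      by simp
  qed
  also have "\<dots> = (\<integral>\<^sup>+y. (\<integral>\<^sup>+x. indicator B (y - T x) * indicator A y \<partial>lborel) \<partial>lborel)"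
    by (rule lborel_pair.Fubini') measurable
  also have "\<dots> = (\<integral>\<^sup>+y. emeasure lborel B * indicator A y \<partial>lborel)"
    by (intro nn_integral_cong) (simp add: nn_integral_multc B)
  also have "\<dots> = emeasure lborel A * emeasure lborel B"
    by (subst nn_integral_cmult) (simp_all add: mult.commute)
  finally have "?L * emeasure lborel B = emeasure lborel A * emeasure lborel B" .
  moreover have "emeasure lborel B \<noteq> 0" "emeasure lborel B \<noteq> \<infinity>"
    using emeasure_lborel_ball_finite[of "0::'a" 1] content_ball_pos[of 1 "0::'a"]
    by (auto simp: B_def measure_def)
  ultimately have "?L = emeasure lborel A"
    by (metis ennreal_mult_cancel_left infinity_ennreal_def mult.commute)
  then show "emeasure (distr lborel borel T) A = emeasure lborel A"
    by (simp add: emeasure_distr)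
qed

section \<open>The standard Gaussian measure on a Euclidean space\<close>

definition std_gaussian :: "'a::euclidean_space measure" where
  "std_gaussian = distr (\<Pi>\<^sub>M b\<in>Basis. std_normal_distribution) borel (\<lambda>f. \<Sum>b\<in>Basis. f b *\<^sub>R b)"

lemma sets_std_gaussian [simp, measurable_cong]: "sets std_gaussian = sets borel"
  by (simp add: std_gaussian_def)

lemma space_std_gaussian [simp]: "space std_gaussian = UNIV"
  by (simp add: std_gaussian_def)

lemma prob_space_std_normal: "prob_space std_normal_distribution"
  by (simp add: prob_space_normal_density)

lemma prob_space_std_gaussian: "prob_space (std_gaussian :: 'a::euclidean_space measure)"
  unfolding std_gaussian_def
  by (intro prob_space.prob_space_distr prob_space_PiM prob_space_std_normal) measurable

text \<open>A finite product measure is determined by its values on boxes, and on a box the integral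
  of the product density splits into one-dimensional integrals.\<close>

lemma PiM_std_normal_distribution:
  assumes "finite I"
  shows "(\<Pi>\<^sub>M i\<in>I. std_normal_distribution)
    = density (\<Pi>\<^sub>M i\<in>I. lborel) (\<lambda>x. \<Prod>i\<in>I. ennreal (std_normal_density (x i)))"
proof -
  interpret N: product_sigma_finite "\<lambda>_. std_normal_distribution"
    by (intro product_sigma_finite.intro prob_space_imp_sigma_finite prob_space_std_normal)
  interpret L: product_sigma_finite "\<lambda>_. lborel :: real measure"
    by unfold_locales
  have [measurable]: "(\<lambda>x. \<Prod>i\<in>I. ennreal (std_normal_density (x i))) \<in> borel_measurable (\<Pi>\<^sub>M i\<in>I. lborel)"
    by (intro borel_measurable_prod_ennreal) measurable
  show ?thesis
  proof (rule N.PiM_eqI[OF assms, symmetric])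
    show "sets (density (\<Pi>\<^sub>M i\<in>I. lborel) (\<lambda>x. \<Prod>i\<in>I. ennreal (std_normal_density (x i))))
      = sets (\<Pi>\<^sub>M i\<in>I. std_normal_distribution)"
      by (simp cong: sets_PiM_cong)
  next
    fix A assume A: "\<And>i. i \<in> I \<Longrightarrow> A i \<in> sets std_normal_distribution"
    have [measurable]: "Pi\<^sub>E I A \<in> sets (\<Pi>\<^sub>M i\<in>I. lborel)"
      using A assms by (intro sets_PiM_I_finite) auto
    have "emeasure (density (\<Pi>\<^sub>M i\<in>I. lborel) (\<lambda>x. \<Prod>i\<in>I. ennreal (std_normal_density (x i)))) (Pi\<^sub>E I A)
      = (\<integral>\<^sup>+x. (\<Prod>i\<in>I. ennreal (std_normal_density (x i))) * indicator (Pi\<^sub>E I A) x \<partial>(\<Pi>\<^sub>M i\<in>I. lborel))"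
      by (intro emeasure_density) measurable
    also have "\<dots> = (\<integral>\<^sup>+x. (\<Prod>i\<in>I. ennreal (std_normal_density (x i)) * indicator (A i) (x i)) \<partial>(\<Pi>\<^sub>M i\<in>I. lborel))"
    proof (intro nn_integral_cong)
      fix x assume "x \<in> space (\<Pi>\<^sub>M i\<in>I. lborel :: real measure)"
      \<comment> \<open>Membership of \<open>x\<close> in the space supplies the extensionality that
        \<open>Pi\<^sub>E\<close> demands and the coordinate indicators do not see.\<close>
      then have "indicator (Pi\<^sub>E I A) x = (\<Prod>i\<in>I. indicator (A i) (x i) :: ennreal)"
        using assms by (auto simp: indicator_def PiE_iff space_PiM prod_zero_iff split: if_splits)
      then show "(\<Prod>i\<in>I. ennreal (std_normal_density (x i))) * indicator (Pi\<^sub>E I A) x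
          = (\<Prod>i\<in>I. ennreal (std_normal_density (x i)) * indicator (A i) (x i))"
        by (simp add: prod.distrib)
    qed
    also have "\<dots> = (\<Prod>i\<in>I. \<integral>\<^sup>+x. ennreal (std_normal_density x) * indicator (A i) x \<partial>lborel)"
      using A assms by (intro L.product_nn_integral_prod) auto
    also have "\<dots> = (\<Prod>i\<in>I. emeasure std_normal_distribution (A i))"
      using A by (intro prod.cong refl emeasure_density[symmetric]) auto
    finally show "emeasure (density (\<Pi>\<^sub>M i\<in>I. lborel) (\<lambda>x. \<Prod>i\<in>I. ennreal (std_normal_density (x i)))) (Pi\<^sub>E I A)
      = (\<Prod>i\<in>I. emeasure std_normal_distribution (A i))" .
  qed
qed

text \<open>The definition as an image of a product makes independence of coordinates visible; this
  second form makes rotation invariance visible, since the density depends on \<open>norm x\<close>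
  only.\<close>

lemma std_gaussian_density:
  "(std_gaussian :: 'a::euclidean_space measure)
    = density lborel (\<lambda>x. ennreal ((1 / sqrt (2 * pi)) ^ DIM('a) * exp (- (norm x)\<^sup>2 / 2)))"
proof -
  let ?g = "\<lambda>x::'a. ennreal ((1 / sqrt (2 * pi)) ^ DIM('a) * exp (- (norm x)\<^sup>2 / 2))"
  have eq: "(\<Prod>b\<in>Basis. ennreal (std_normal_density (x b))) = ?g (\<Sum>b\<in>Basis. x b *\<^sub>R b)" for x
  proof -
    have "(norm (\<Sum>b\<in>Basis. x b *\<^sub>R b :: 'a))\<^sup>2 = (\<Sum>b\<in>(Basis::'a set). (x b)\<^sup>2)"
      unfolding power2_norm_eq_inner
      by (subst euclidean_inner) (simp add: inner_sum_left_Basis power2_eq_square)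
    then show ?thesis
      by (simp add: prod_ennreal normal_density_def prod_dividef exp_sum[symmetric]
        sum_divide_distrib[symmetric] sum_negf power_one_over prod.distrib flip: exp_sum)
  qed
  have "(std_gaussian :: 'a measure)
    = distr (density (\<Pi>\<^sub>M b\<in>Basis. lborel) (\<lambda>x. ?g (\<Sum>b\<in>Basis. x b *\<^sub>R b))) borel (\<lambda>f. \<Sum>b\<in>Basis. f b *\<^sub>R b)"
    by (simp add: std_gaussian_def PiM_std_normal_distribution eq)
  also have "\<dots> = density (distr (\<Pi>\<^sub>M b\<in>Basis. lborel) borel (\<lambda>f. \<Sum>b\<in>Basis. f b *\<^sub>R b)) ?g"
    by (rule density_distr[symmetric]) measurable
  finally show ?thesis by (simp flip: lborel_eq)
qed

text \<open>Both ingredients are invariant: the density because \<open>T\<close> preserves norms,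
  and Lebesgue measure by \<open>lborel_distr_orthogonal_transformation\<close>.\<close>

lemma std_gaussian_distr_orthogonal_transformation:
  fixes T :: "'a::euclidean_space \<Rightarrow> 'a"
  assumes T: "orthogonal_transformation T"
  shows "distr std_gaussian borel T = std_gaussian"
proof -
  have [measurable]: "T \<in> borel_measurable borel"
    using T by (intro borel_measurable_continuous_onI linear_continuous_on linear_conv_bounded_linear[THEN iffD1] orthogonal_transformation_linear)
  let ?g = "\<lambda>x::'a. ennreal ((1 / sqrt (2 * pi)) ^ DIM('a) * exp (- (norm x)\<^sup>2 / 2))"
  have "distr std_gaussian borel T = distr (density lborel (\<lambda>x. ?g (T x))) borel T"
    by (simp add: std_gaussian_density orthogonal_transformation_norm[OF T])
  also have "\<dots> = density (distr lborel borel T) ?g"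
    by (rule density_distr[symmetric]) measurable
  finally show ?thesis
    by (simp add: std_gaussian_density lborel_distr_orthogonal_transformation[OF T])
qed

text \<open>Criterion for recognizing a Gaussian vector: independence turns the joint law of the
  coordinates into the product of their marginals. It is applied to the random matrix
  \<open>Z\<close>.\<close>

lemma (in prob_space) distr_std_gaussian:
  fixes W :: "'a \<Rightarrow> 'b::euclidean_space"
  assumes indep: "indep_vars (\<lambda>_. borel) (\<lambda>b \<omega>. W \<omega> \<bullet> b) Basis"
    and std: "\<And>b. b \<in> Basis \<Longrightarrow> distributed M lborel (\<lambda>\<omega>. W \<omega> \<bullet> b) std_normal_density"
  shows "distr M borel W = std_gaussian"
proof -
  have [measurable]: "(\<lambda>\<omega>. W \<omega> \<bullet> b) \<in> borel_measurable M" if "b \<in> Basis" for b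
    using std[OF that] by (auto dest: distributed_measurable)
  have d: "distr M borel (\<lambda>\<omega>. W \<omega> \<bullet> b) = std_normal_distribution" if "b \<in> Basis" for b
    using std[OF that] unfolding distributed_def by (metis distr_cong sets_lborel)
  have "(\<Pi>\<^sub>M b\<in>Basis. std_normal_distribution) = (\<Pi>\<^sub>M b\<in>(Basis::'b set). distr M borel (\<lambda>\<omega>. W \<omega> \<bullet> b))"
    by (intro PiM_cong) (simp_all add: d)
  also have "\<dots> = distr M (\<Pi>\<^sub>M b\<in>Basis. borel) (\<lambda>\<omega>. \<lambda>b\<in>Basis. W \<omega> \<bullet> b)"
    using indep by (subst (asm) indep_vars_iff_distr_eq_PiM') auto
  finally have "std_gaussian = distr (distr M (\<Pi>\<^sub>M b\<in>(Basis::'b set). borel) (\<lambda>\<omega>. \<lambda>b\<in>Basis. W \<omega> \<bullet> b)) borel (\<lambda>f. \<Sum>b\<in>Basis. f b *\<^sub>R b)"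
    by (simp add: std_gaussian_def)
  also have "\<dots> = distr M borel W"
    by (subst distr_distr) (auto simp: o_def euclidean_representation intro!: distr_cong)
  finally show ?thesis ..
qed

subsection \<open>Gamma and Beta distributions\<close>

text \<open>Shape \<open>a\<close> and rate 1. With this normalization it is half the square of a
  standard normal variable that has a Gamma law, which explains the factors 1/2 below.\<close>

definition gamma_density :: "real \<Rightarrow> real \<Rightarrow> real" where
  "gamma_density a x = indicator {0<..} x * (x powr (a - 1) * exp (- x) / Gamma a)"

definition gamma_distribution :: "real \<Rightarrow> real measure" where
  "gamma_distribution a = density lborel (\<lambda>x. ennreal (gamma_density a x))"

definition beta_density :: "real \<Rightarrow> real \<Rightarrow> real \<Rightarrow> real" where
  "beta_density a b x = indicator {0<..<1} x * (x powr (a - 1) * (1 - x) powr (b - 1) / Beta a b)"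

lemma borel_measurable_gamma_density [measurable]: "gamma_density a \<in> borel_measurable borel"
  unfolding gamma_density_def by measurable

lemma borel_measurable_beta_density [measurable]: "beta_density a b \<in> borel_measurable borel"
  unfolding beta_density_def by measurable

lemma gamma_density_nonneg: "a > 0 \<Longrightarrow> 0 \<le> gamma_density a x"
  using Gamma_real_pos[of a] by (simp add: gamma_density_def)

lemma beta_density_nonneg: "a > 0 \<Longrightarrow> b > 0 \<Longrightarrow> 0 \<le> beta_density a b x"
  using Gamma_real_pos[of a] Gamma_real_pos[of b] Gamma_real_pos[of "a + b"]
  by (simp add: beta_density_def Beta_def)

lemma sets_gamma_distribution [simp, measurable_cong]: "sets (gamma_distribution a) = sets borel"
  by (simp add: gamma_distribution_def)

lemma space_gamma_distribution [simp]: "space (gamma_distribution a) = UNIV"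
  by (simp add: gamma_distribution_def)

lemma nn_integral_gamma_density:
  assumes "a > 0"
  shows "(\<integral>\<^sup>+x. ennreal (gamma_density a x) \<partial>lborel) = 1"
proof -
  have G: "Gamma a > 0" using assms by (rule Gamma_real_pos)
  have "(\<integral>\<^sup>+x. ennreal (gamma_density a x) \<partial>lborel)
    = (\<integral>\<^sup>+x. ennreal (1 / Gamma a) * ennreal (indicator {0..} x * x powr (a - 1) / exp x) \<partial>lborel)"
    using G by (intro nn_integral_cong)
      (auto simp: gamma_density_def indicator_def exp_minus divide_simps simp flip: ennreal_mult split: if_splits)
  also have "\<dots> = ennreal (1 / Gamma a) * ennreal (Gamma a)"
    by (subst nn_integral_cmult) (simp_all add: Gamma_conv_nn_integral_real[OF assms])
  also have "\<dots> = 1"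
    using G by (simp flip: ennreal_mult)
  finally show ?thesis .
qed

lemma prob_space_gamma_distribution: "a > 0 \<Longrightarrow> prob_space (gamma_distribution a)"
  by (rule prob_spaceI)
     (simp add: gamma_distribution_def emeasure_density nn_integral_gamma_density)

text \<open>Change of variables \<open>s = x + y\<close>, \<open>u = x / (x + y)\<close>: the joint
  density becomes a Gamma density in \<open>s\<close> times a Beta density in \<open>u\<close>. A
  general \<open>f\<close> is kept because three facts follow by specialization:
  \<open>f = 1\<close> normalizes the Beta density, \<open>f\<close> depending on \<open>s\<close>
  alone gives the convolution, and \<open>f\<close> depending on \<open>u\<close> alone gives the
  law of the ratio.\<close>

lemma nn_integral_gamma_pair:
  fixes f :: "real \<Rightarrow> real \<Rightarrow> ennreal"
  assumes a: "a > 0" and b: "b > 0"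
    and f [measurable]: "case_prod f \<in> borel_measurable (borel \<Otimes>\<^sub>M borel)"
  shows "(\<integral>\<^sup>+p. f (fst p + snd p) (fst p / (fst p + snd p)) \<partial>(gamma_distribution a \<Otimes>\<^sub>M gamma_distribution b))
    = (\<integral>\<^sup>+s. (\<integral>\<^sup>+u. f s u * beta_density a b u \<partial>lborel) \<partial>gamma_distribution (a + b))"
proof -
  interpret A: prob_space "gamma_distribution a" using a by (rule prob_space_gamma_distribution)
  interpret B: prob_space "gamma_distribution b" using b by (rule prob_space_gamma_distribution)
  interpret AB: pair_prob_space "gamma_distribution a" "gamma_distribution b" ..
  let ?g = gamma_density
  have G: "Gamma a > 0" "Gamma b > 0" "Gamma (a + b) > 0"
    using a b by (auto intro: Gamma_real_pos)
  \<comment> \<open>For fixed sum \<open>s\<close>, substitute \<open>x = s * u\<close>. If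
    \<open>s\<close> is not positive, then \<open>x\<close> and \<open>s - x\<close> cannot both be
    positive and both sides vanish.\<close>
  have key: "(\<integral>\<^sup>+x. ?g a x * (?g b (s - x) * f s (x / s)) \<partial>lborel)
    = ?g (a + b) s * (\<integral>\<^sup>+u. f s u * beta_density a b u \<partial>lborel)" for s
  proof (cases "s > 0")
    case False
    then have "ennreal (?g a x) * (?g b (s - x) * f s (x / s)) = 0" for x
      by (auto simp: gamma_density_def indicator_def)
    then have "(\<integral>\<^sup>+x. ?g a x * (?g b (s - x) * f s (x / s)) \<partial>lborel) = 0"
      by (simp only: nn_integral_const mult_zero_left)
    moreover have "?g (a + b) s = 0" using False by (simp add: gamma_density_def)
    ultimately show ?thesis by simp
  next
    case True
    \<comment> \<open>The leading \<open>s\<close> is the Jacobian of \<open>x = s * u\<close>. The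
      exponentials combine to \<open>exp (- s)\<close>, the powers of \<open>s\<close> to exponent
      \<open>a + b - 1\<close>, and the Gamma constants to
      \<open>Gamma (a + b) * Beta a b\<close>.\<close>
    have dens: "s * (?g a (s * u) * ?g b (s - s * u)) = ?g (a + b) s * beta_density a b u" for u
    proof (cases "0 < u \<and> u < 1")
      case False
      then have "\<not> (0 < s * u \<and> 0 < s - s * u)"
        using True by (auto simp: zero_less_mult_iff)
      then show ?thesis using False by (auto simp: gamma_density_def beta_density_def indicator_def)
    next
      case u: True
      have pos: "0 < s * u" "0 < s - s * u" using True u by auto
      have eq: "s - s * u = s * (1 - u)" by (simp add: algebra_simps)
      have 1: "s * (s powr (a - 1) * s powr (b - 1)) = s powr (a + b - 1)"
        using True by (simp add: powr_add [symmetric] powr_mult_base)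
      have "s * (?g a (s * u) * ?g b (s - s * u)) =
          (s * (s powr (a - 1) * s powr (b - 1))) * (exp (- (s * u)) * exp (- (s - s * u)))
          * (u powr (a - 1) * (1 - u) powr (b - 1)) / (Gamma a * Gamma b)"
        using pos True u unfolding gamma_density_def by (simp add: eq powr_mult mult_ac)
      also have "exp (- (s * u)) * exp (- (s - s * u)) = exp (- s)"
        by (simp flip: exp_add)
      finally show ?thesis
        using pos True u G by (simp add: 1 gamma_density_def beta_density_def Beta_def field_simps)
    qed
    have "(\<integral>\<^sup>+x. ?g a x * (?g b (s - x) * f s (x / s)) \<partial>lborel)
      = ennreal \<bar>s\<bar> * (\<integral>\<^sup>+u. ?g a (0 + s * u) * (?g b (s - (0 + s * u)) * f s ((0 + s * u) / s)) \<partial>lborel)"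
      using True by (intro nn_integral_real_affine) simp_all
    also have "\<dots> = (\<integral>\<^sup>+u. ennreal \<bar>s\<bar> * (?g a (0 + s * u) * (?g b (s - (0 + s * u)) * f s ((0 + s * u) / s))) \<partial>lborel)"
      by (intro nn_integral_cmult[symmetric]) measurable
    also have "\<dots> = (\<integral>\<^sup>+u. ?g (a + b) s * (f s u * beta_density a b u) \<partial>lborel)"
    proof (rule nn_integral_cong)
      fix u
      have "ennreal \<bar>s\<bar> * (?g a (0 + s * u) * (?g b (s - (0 + s * u)) * f s ((0 + s * u) / s)))
        = ennreal (s * (?g a (s * u) * ?g b (s - s * u))) * f s u"
        using True a b by (simp add: ennreal_mult gamma_density_nonneg mult_ac)
      also have "\<dots> = ?g (a + b) s * (f s u * beta_density a b u)"
        using a b unfolding dens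
        by (simp add: ennreal_mult gamma_density_nonneg beta_density_nonneg mult_ac)
      finally show "ennreal \<bar>s\<bar> * (?g a (0 + s * u) * (?g b (s - (0 + s * u)) * f s ((0 + s * u) / s)))
         = ?g (a + b) s * (f s u * beta_density a b u)" .
    qed
    also have "\<dots> = ?g (a + b) s * (\<integral>\<^sup>+u. f s u * beta_density a b u \<partial>lborel)"
      by (intro nn_integral_cmult) measurable
    finally show ?thesis .
  qed
  have "(\<integral>\<^sup>+p. f (fst p + snd p) (fst p / (fst p + snd p)) \<partial>(gamma_distribution a \<Otimes>\<^sub>M gamma_distribution b))
    = (\<integral>\<^sup>+x. \<integral>\<^sup>+y. f (x + y) (x / (x + y)) \<partial>gamma_distribution b \<partial>gamma_distribution a)"
    by (subst B.nn_integral_fst[symmetric]) (simp_all, measurable)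
  also have "\<dots> = (\<integral>\<^sup>+x. ?g a x * (\<integral>\<^sup>+y. ?g b y * f (x + y) (x / (x + y)) \<partial>lborel) \<partial>lborel)"
    unfolding gamma_distribution_def by (simp add: nn_integral_density)
  also have "\<dots> = (\<integral>\<^sup>+x. ?g a x * (\<integral>\<^sup>+s. ?g b (s - x) * f s (x / s) \<partial>lborel) \<partial>lborel)"
  proof (rule nn_integral_cong)
    fix x
    show "?g a x * (\<integral>\<^sup>+y. ?g b y * f (x + y) (x / (x + y)) \<partial>lborel)
      = ?g a x * (\<integral>\<^sup>+s. ?g b (s - x) * f s (x / s) \<partial>lborel)"
      by (subst (2) nn_integral_real_affine[of _ 1 x]) (simp_all, measurable)
  qed
  also have "\<dots> = (\<integral>\<^sup>+x. (\<integral>\<^sup>+s. ?g a x * (?g b (s - x) * f s (x / s)) \<partial>lborel) \<partial>lborel)"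
    by (intro nn_integral_cong nn_integral_cmult[symmetric]) measurable
  also have "\<dots> = (\<integral>\<^sup>+s. (\<integral>\<^sup>+x. ?g a x * (?g b (s - x) * f s (x / s)) \<partial>lborel) \<partial>lborel)"
    by (rule lborel_pair.Fubini') measurable
  also have "\<dots> = (\<integral>\<^sup>+s. (\<integral>\<^sup>+u. f s u * beta_density a b u \<partial>lborel) \<partial>gamma_distribution (a + b))"
    unfolding key gamma_distribution_def by (subst nn_integral_density) (simp_all, measurable)
  finally show ?thesis .
qed

text \<open>With the constant \<open>f = 1\<close>, the preceding identity equates the total mass of
  a product of probability measures with this integral.\<close>

lemma nn_integral_beta_density:
  assumes "a > 0" "b > 0"
  shows "(\<integral>\<^sup>+u. ennreal (beta_density a b u) \<partial>lborel) = 1"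
proof -
  interpret A: prob_space "gamma_distribution a" using assms by (intro prob_space_gamma_distribution)
  interpret B: prob_space "gamma_distribution b" using assms by (intro prob_space_gamma_distribution)
  interpret AB: pair_prob_space "gamma_distribution a" "gamma_distribution b" ..
  interpret C: prob_space "gamma_distribution (a + b)" using assms by (intro prob_space_gamma_distribution) simp
  show ?thesis
    using nn_integral_gamma_pair[OF assms, of "\<lambda>_ _. 1"]
      AB.emeasure_space_1 C.emeasure_space_1
    by (simp add: space_pair_measure)
qed

lemma gamma_distribution_convolution:
  assumes "a > 0" "b > 0"
  shows "gamma_distribution a \<star> gamma_distribution b = gamma_distribution (a + b)"
proof (rule measure_eqI)
  show "sets (gamma_distribution a \<star> gamma_distribution b) = sets (gamma_distribution (a + b))"
    by simp
next
  fix A assume "A \<in> sets (gamma_distribution a \<star> gamma_distribution b)"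
  then have [measurable]: "A \<in> sets borel" by simp
  have "emeasure (gamma_distribution a \<star> gamma_distribution b) A
    = (\<integral>\<^sup>+p. indicator A (fst p + snd p) \<partial>(gamma_distribution a \<Otimes>\<^sub>M gamma_distribution b))"
    unfolding convolution_def
    by (subst nn_integral_indicator[symmetric], simp, subst nn_integral_distr) (auto simp: case_prod_beta')
  also have "\<dots> = (\<integral>\<^sup>+s. indicator A s \<partial>gamma_distribution (a + b))"
    using nn_integral_gamma_pair[OF assms, of "\<lambda>s _. indicator A s"]
    by (simp add: nn_integral_cmult nn_integral_beta_density[OF assms])
  finally show "emeasure (gamma_distribution a \<star> gamma_distribution b) A = emeasure (gamma_distribution (a + b)) A"
    by simp
qed

lemma beta_distribution_density:
  assumes "a > 0" "b > 0"
  shows "beta_distribution a b = density lborel (\<lambda>x. ennreal (beta_density a b x))"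
  using assms by (simp add: beta_distribution_def beta_density_def)

lemma gamma_distribution_ratio:
  assumes "a > 0" "b > 0"
  shows "distr (gamma_distribution a \<Otimes>\<^sub>M gamma_distribution b) borel (\<lambda>(x, y). x / (x + y))
    = beta_distribution a b"
proof (rule measure_eqI)
  show "sets (distr (gamma_distribution a \<Otimes>\<^sub>M gamma_distribution b) borel (\<lambda>(x, y). x / (x + y)))
     = sets (beta_distribution a b)"
    by (simp add: beta_distribution_def)
next
  fix A assume "A \<in> sets (distr (gamma_distribution a \<Otimes>\<^sub>M gamma_distribution b) borel (\<lambda>(x, y). x / (x + y)))"
  then have [measurable]: "A \<in> sets borel" by simp
  interpret C: prob_space "gamma_distribution (a + b)" using assms by (intro prob_space_gamma_distribution) simp
  have "emeasure (distr (gamma_distribution a \<Otimes>\<^sub>M gamma_distribution b) borel (\<lambda>(x, y). x / (x + y))) A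
    = (\<integral>\<^sup>+p. indicator A (fst p / (fst p + snd p)) \<partial>(gamma_distribution a \<Otimes>\<^sub>M gamma_distribution b))"
    by (subst nn_integral_indicator[symmetric], simp, subst nn_integral_distr) (auto simp: case_prod_beta')
  also have "\<dots> = (\<integral>\<^sup>+u. indicator A u * ennreal (beta_density a b u) \<partial>lborel)"
    using nn_integral_gamma_pair[OF assms, of "\<lambda>_ u. indicator A u"] C.emeasure_space_1
    by simp
  also have "\<dots> = emeasure (beta_distribution a b) A"
    unfolding beta_distribution_density[OF assms]
    by (subst emeasure_density) (simp_all add: mult.commute)
  finally show "emeasure (distr (gamma_distribution a \<Otimes>\<^sub>M gamma_distribution b) borel (\<lambda>(x, y). x / (x + y))) A
    = emeasure (beta_distribution a b) A" .
qed

text \<open>By symmetry the mass is twice that of \<open>{0..r}\<close>, and the substitution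
  \<open>t = x\<^sup>2 / 2\<close>, with derivative \<open>x\<close>, turns the doubled normal
  density into the Gamma density of shape 1/2; the constants match through
  \<open>Gamma (1 / 2) = sqrt pi\<close>.\<close>

lemma std_normal_interval:
  assumes "0 \<le> r"
  shows "emeasure std_normal_distribution {-r..r} = emeasure (gamma_distribution (1 / 2)) {..r\<^sup>2 / 2}"
proof -
  let ?\<phi> = "\<lambda>x. ennreal (std_normal_density x)"
  have "emeasure std_normal_distribution {-r..r} = (\<integral>\<^sup>+x. ?\<phi> x * indicator {-r..r} x \<partial>lborel)"
    by (simp add: emeasure_density)
  also have "\<dots> = (\<integral>\<^sup>+x. ?\<phi> x * indicator {-r..0} x + ?\<phi> x * indicator {0..r} x \<partial>lborel)"
    by (rule nn_integral_cong_AE, use AE_lborel_singleton[of 0] in eventually_elim)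
       (use assms in \<open>auto simp: indicator_def\<close>)
  also have "\<dots> = (\<integral>\<^sup>+x. ?\<phi> x * indicator {-r..0} x \<partial>lborel) + (\<integral>\<^sup>+x. ?\<phi> x * indicator {0..r} x \<partial>lborel)"
    by (rule nn_integral_add) measurable
  finally have split: "emeasure std_normal_distribution {-r..r}
    = (\<integral>\<^sup>+x. ?\<phi> x * indicator {-r..0} x \<partial>lborel) + (\<integral>\<^sup>+x. ?\<phi> x * indicator {0..r} x \<partial>lborel)" .
  have flip: "(\<integral>\<^sup>+x. ?\<phi> x * indicator {-r..0} x \<partial>lborel) = (\<integral>\<^sup>+x. ?\<phi> x * indicator {0..r} x \<partial>lborel)"
    by (subst nn_integral_real_affine[of _ "-1" 0])
       (auto simp: normal_density_def indicator_def intro!: nn_integral_cong)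
  have "emeasure std_normal_distribution {-r..r}
      = (\<integral>\<^sup>+x. ?\<phi> x * indicator {0..r} x + ?\<phi> x * indicator {0..r} x \<partial>lborel)"
    unfolding split flip by (rule nn_integral_add[symmetric]) measurable
  also have "\<dots> = (\<integral>\<^sup>+x. ennreal (gamma_density (1 / 2) (x\<^sup>2 / 2) * x * indicator {0..r} x) \<partial>lborel)"
  \<comment> \<open>The point 0 must be discarded: there the left side is positive, while the factor
    \<open>x\<close> makes the right side 0.\<close>
  proof (rule nn_integral_cong_AE, use AE_lborel_singleton[of 0] in eventually_elim)
    fix x :: real assume "x \<noteq> 0"
    show "?\<phi> x * indicator {0..r} x + ?\<phi> x * indicator {0..r} x
        = ennreal (gamma_density (1 / 2) (x\<^sup>2 / 2) * x * indicator {0..r} x)"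
    proof (cases "x \<in> {0..r}")
      case True
      then have x: "x > 0" using \<open>x \<noteq> 0\<close> by simp
      have "(x\<^sup>2 / 2) powr (1 / 2 - 1) = inverse ((x\<^sup>2 / 2) powr (1 / 2))"
        using powr_minus[of "x\<^sup>2 / 2" "1 / 2"] by simp
      also have "\<dots> = sqrt 2 / x"
        using x by (simp add: powr_half_sqrt real_sqrt_divide)
      finally have "gamma_density (1 / 2) (x\<^sup>2 / 2) * x = sqrt 2 * exp (- (x\<^sup>2 / 2)) / sqrt pi"
        using x by (simp add: gamma_density_def Gamma_one_half_real)
      also have "\<dots> = 2 * std_normal_density x"
        by (simp add: normal_density_def real_sqrt_mult) (simp add: divide_simps)
      finally have "ennreal (gamma_density (1 / 2) (x\<^sup>2 / 2) * x) = ?\<phi> x + ?\<phi> x"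
        by (simp only: mult_2 ennreal_plus normal_density_nonneg)
      then show ?thesis using True by simp
    qed simp
  qed
  also have "\<dots> = (\<integral>\<^sup>+x. ennreal (gamma_density (1 / 2) x * indicator {0\<^sup>2 / 2..r\<^sup>2 / 2} x) \<partial>lborel)"
    using assms
    by (intro nn_integral_substitution[symmetric])
       (auto intro!: derivative_eq_intros continuous_intros simp: set_borel_measurable_def)
  also have "\<dots> = emeasure (gamma_distribution (1 / 2)) {..r\<^sup>2 / 2}"
    by (auto simp: gamma_distribution_def gamma_density_def emeasure_density indicator_def
      intro!: nn_integral_cong)
  finally show ?thesis .
qed

text \<open>The distribution functions agree: \<open>x\<^sup>2 / 2 \<le> t\<close> is impossible for
  negative \<open>t\<close>, and otherwise describes the interval \<open>{-r..r}\<close> with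
  \<open>r = sqrt (2 * t)\<close>.\<close>

lemma std_normal_half_square:
  "distr std_normal_distribution borel (\<lambda>x. x\<^sup>2 / 2) = gamma_distribution (1 / 2)"
proof (rule cdf_unique)
  interpret N: prob_space std_normal_distribution by (simp add: prob_space_normal_density)
  interpret G: prob_space "gamma_distribution (1 / 2)" by (rule prob_space_gamma_distribution) simp
  show "real_distribution (distr std_normal_distribution borel (\<lambda>x. x\<^sup>2 / 2))"
    by (intro N.real_distribution_distr) measurable
  show "real_distribution (gamma_distribution (1 / 2))"
    by unfold_locales simp_all
  show "cdf (distr std_normal_distribution borel (\<lambda>x. x\<^sup>2 / 2)) = cdf (gamma_distribution (1 / 2))"
  proof
    fix t :: real
    have "emeasure std_normal_distribution {x. x\<^sup>2 / 2 \<le> t} = emeasure (gamma_distribution (1 / 2)) {..t}"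
    proof (cases "t \<ge> 0")
      case False
      have "{x::real. x\<^sup>2 / 2 \<le> t} = {}"
      proof -
        have "t < x\<^sup>2 / 2" for x :: real
          using False zero_le_power2[of x] by linarith
        then show ?thesis by (auto simp: not_le)
      qed
      moreover have "emeasure (gamma_distribution (1 / 2)) {..t} = 0"
        using False
        by (auto simp: gamma_distribution_def gamma_density_def emeasure_density indicator_def
          intro!: nn_integral_zero')
      ultimately show ?thesis by simp
    next
      case True
      define r where "r = sqrt (2 * t)"
      have r: "r \<ge> 0" "r\<^sup>2 / 2 = t" using True by (simp_all add: r_def)
      have set: "{x::real. x\<^sup>2 / 2 \<le> t} = {-r..r}"
      proof -
        have "x\<^sup>2 / 2 \<le> t \<longleftrightarrow> - r \<le> x \<and> x \<le> r" for x
          unfolding r(2)[symmetric] using r(1) abs_le_square_iff[of x r] by linarith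
        then show ?thesis by (intro set_eqI) (simp only: mem_Collect_eq atLeastAtMost_iff)
      qed
      then show ?thesis
        using std_normal_interval[OF r(1)] by (simp add: r(2))
    qed
    then show "cdf (distr std_normal_distribution borel (\<lambda>x. x\<^sup>2 / 2)) t = cdf (gamma_distribution (1 / 2)) t"
      by (simp add: cdf_def measure_def emeasure_distr vimage_def)
  qed
qed

section \<open>Sums of squares of independent standard normal variables\<close>

context prob_space
begin

lemma distr_half_square:
  assumes "distributed M lborel Y std_normal_density"
  shows "distr M borel (\<lambda>\<omega>. (Y \<omega>)\<^sup>2 / 2) = gamma_distribution (1 / 2)"
proof -
  have [measurable]: "Y \<in> borel_measurable M"
    using assms by (auto dest: distributed_measurable)
  have "distr M borel (\<lambda>\<omega>. (Y \<omega>)\<^sup>2 / 2) = distr (distr M lborel Y) borel (\<lambda>x. x\<^sup>2 / 2)"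
    by (subst distr_distr) (auto simp: o_def)
  also have "distr M lborel Y = std_normal_distribution"
    using assms by (simp add: distributed_def)
  finally show ?thesis by (simp add: std_normal_half_square)
qed

lemma indep_vars_half_square:
  assumes "indep_vars (\<lambda>_. borel) X I"
  shows "indep_vars (\<lambda>_. borel) (\<lambda>i \<omega>. (X i \<omega>)\<^sup>2 / 2 :: real) I"
  by (rule indep_vars_compose2[OF assms]) measurable

text \<open>This is half of a chi-squared variable. Each new index adds an independent Gamma
  variable of shape 1/2; the induction starts from singletons because the convolution rule requires
  positive shapes.\<close>

lemma distr_half_sum_squares:
  assumes "finite I" "I \<noteq> {}"
    and "indep_vars (\<lambda>_. borel) X I"
    and "\<And>i. i \<in> I \<Longrightarrow> distributed M lborel (X i) std_normal_density"
  shows "distr M borel (\<lambda>\<omega>. \<Sum>i\<in>I. (X i \<omega>)\<^sup>2 / 2) = gamma_distribution (card I / 2)"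
  using assms
proof (induction I rule: finite_ne_induct)
  case (singleton i)
  then show ?case by (simp add: distr_half_square)
next
  case (insert i I)
  have [measurable]: "X j \<in> borel_measurable M" if "j \<in> insert i I" for j
    using insert.prems(2)[OF that] by (auto dest: distributed_measurable)
  have "indep_vars (\<lambda>_. borel) X I"
    by (rule indep_vars_subset[OF insert.prems(1)]) auto
  then have IH: "distr M borel (\<lambda>\<omega>. \<Sum>i\<in>I. (X i \<omega>)\<^sup>2 / 2) = gamma_distribution (card I / 2)"
    using insert by simp
  have "indep_var borel (\<lambda>\<omega>. (X i \<omega>)\<^sup>2 / 2) borel (\<lambda>\<omega>. \<Sum>i\<in>I. (X i \<omega>)\<^sup>2 / 2)"
    using insert by (intro indep_vars_sum indep_vars_half_square) auto
  then have "distr M borel (\<lambda>\<omega>. (X i \<omega>)\<^sup>2 / 2 + (\<Sum>i\<in>I. (X i \<omega>)\<^sup>2 / 2))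
    = (gamma_distribution (1 / 2) \<star> gamma_distribution (card I / 2))"
    using insert by (subst sum_indep_random_variable) (auto simp: IH distr_half_square)
  also have "\<dots> = gamma_distribution (1 / 2 + card I / 2)"
    using insert by (intro gamma_distribution_convolution) (auto simp: card_gt_0_iff)
  finally show ?case
    using insert by (simp add: add_divide_distrib)
qed

text \<open>Halving all squares leaves the ratio unchanged and writes it as
  \<open>A / (A + B)\<close>, where \<open>A\<close> and \<open>B\<close> are sums over disjoint
  blocks, hence independent. Both blocks are nonempty, so both Gamma shapes are positive.\<close>

lemma distr_square_ratio:
  assumes I: "finite I" "S \<subseteq> I" "S \<noteq> {}" "I - S \<noteq> {}"
    and indep: "indep_vars (\<lambda>_. borel) X I"
    and std: "\<And>i. i \<in> I \<Longrightarrow> distributed M lborel (X i) std_normal_density"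
  shows "distr M borel (\<lambda>\<omega>. (\<Sum>i\<in>S. (X i \<omega>)\<^sup>2) / (\<Sum>i\<in>I. (X i \<omega>)\<^sup>2))
    = beta_distribution (card S / 2) (card (I - S) / 2)"
proof -
  have [measurable]: "X j \<in> borel_measurable M" if "j \<in> I" for j
    using std[OF that] by (auto dest: distributed_measurable)
  let ?A = "\<lambda>\<omega>. \<Sum>i\<in>S. (X i \<omega>)\<^sup>2 / 2" and ?B = "\<lambda>\<omega>. \<Sum>i\<in>I - S. (X i \<omega>)\<^sup>2 / 2"
  have fin: "finite S" "finite (I - S)" using I finite_subset by auto
  have [measurable]: "?A \<in> borel_measurable M" "?B \<in> borel_measurable M"
    using I by (auto intro!: borel_measurable_sum)
  \<comment> \<open>The sums are presented as functions of the two restricted families, for which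
    independence of disjoint blocks is available.\<close>
  have "indep_var borel ((\<lambda>f. \<Sum>i\<in>S. f i) \<circ> (\<lambda>\<omega>. restrict (\<lambda>i. (X i \<omega>)\<^sup>2 / 2) S))
      borel ((\<lambda>f. \<Sum>i\<in>I - S. f i) \<circ> (\<lambda>\<omega>. restrict (\<lambda>i. (X i \<omega>)\<^sup>2 / 2) (I - S)))"
    using I by (intro indep_var_compose[OF indep_var_restrict[OF indep_vars_half_square[OF indep]]]) auto
  then have ind: "indep_var borel ?A borel ?B"
    by (simp only: o_def restrict_apply' cong: sum.cong)
  have "indep_vars (\<lambda>_. borel) X S" "indep_vars (\<lambda>_. borel) X (I - S)"
    using I by (auto intro: indep_vars_subset[OF indep])
  then have A: "distr M borel ?A = gamma_distribution (card S / 2)"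
    and B: "distr M borel ?B = gamma_distribution (card (I - S) / 2)"
    using I fin std by (auto intro!: distr_half_sum_squares)
  have eq: "(\<Sum>i\<in>S. (X i \<omega>)\<^sup>2) / (\<Sum>i\<in>I. (X i \<omega>)\<^sup>2) = ?A \<omega> / (?A \<omega> + ?B \<omega>)" for \<omega>
    using I by (simp add: sum.subset_diff[of S I] flip: sum_divide_distrib add_divide_distrib)
  have "beta_distribution (card S / 2) (card (I - S) / 2)
    = distr (distr M borel ?A \<Otimes>\<^sub>M distr M borel ?B) borel (\<lambda>(x, y). x / (x + y))"
    unfolding A B using I fin
    by (intro gamma_distribution_ratio[symmetric]) (auto simp: card_gt_0_iff)
  also have "distr M borel ?A \<Otimes>\<^sub>M distr M borel ?B = distr M (borel \<Otimes>\<^sub>M borel) (\<lambda>\<omega>. (?A \<omega>, ?B \<omega>))"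
    using ind by (simp add: indep_var_distribution_eq)
  also have "distr \<dots> borel (\<lambda>(x, y). x / (x + y)) = distr M borel (\<lambda>\<omega>. ?A \<omega> / (?A \<omega> + ?B \<omega>))"
    by (subst distr_distr) (auto simp: o_def)
  finally show ?thesis by (simp add: eq)
qed

end

lemma AE_std_gaussian_nonzero: "AE x in (std_gaussian :: 'a::euclidean_space measure). x \<noteq> 0"
  unfolding std_gaussian_density
  by (subst AE_density) (use AE_lborel_singleton[of "0::'a"] in \<open>auto elim: eventually_mono\<close>)

text \<open>If \<open>S\<close> is all of \<open>Basis\<close>, the ratio is 1 off the null set
  \<open>{0}\<close>, which matches the convention for \<open>Beta(a, 0)\<close>. Otherwise the
  coordinates under the product measure are independent normal variables and
  \<open>distr_square_ratio\<close> applies.\<close>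

lemma distr_std_gaussian_square_ratio:
  fixes S :: "'a::euclidean_space set"
  assumes S: "S \<subseteq> Basis" "S \<noteq> {}"
  shows "distr std_gaussian borel (\<lambda>x. (\<Sum>b\<in>S. (x \<bullet> b)\<^sup>2) / (norm x)\<^sup>2)
    = beta_distribution (card S / 2) (card (Basis - S) / 2)"
proof -
  have norm: "(norm x)\<^sup>2 = (\<Sum>b\<in>Basis. (x \<bullet> b)\<^sup>2)" for x :: 'a
    unfolding power2_norm_eq_inner by (subst euclidean_inner) (simp add: power2_eq_square)
  show ?thesis
  proof (cases "Basis - S = {}")
    case True
    interpret G: prob_space "std_gaussian :: 'a measure" by (rule prob_space_std_gaussian)
    have "S = Basis" using True S by auto
    have "distr std_gaussian borel (\<lambda>x::'a. (\<Sum>b\<in>S. (x \<bullet> b)\<^sup>2) / (norm x)\<^sup>2)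
      = distr std_gaussian borel (\<lambda>x::'a. 1)"
      using AE_std_gaussian_nonzero
      by (intro distr_cong_AE) (auto simp: \<open>S = Basis\<close> simp flip: norm elim: eventually_mono)
    also have "\<dots> = return borel 1" by (rule G.distr_const) simp
    finally show ?thesis unfolding True by (simp add: beta_distribution_def)
  next
    case False
    let ?P = "\<Pi>\<^sub>M b\<in>(Basis :: 'a set). std_normal_distribution"
    interpret P: prob_space ?P by (intro prob_space_PiM prob_space_std_normal)
    have comp: "distr ?P borel (\<lambda>f. f b) = std_normal_distribution" if "b \<in> Basis" for b :: 'a
      using distr_PiM_component[of Basis "\<lambda>_. std_normal_distribution" b] that prob_space_std_normal
      by (metis (no_types, lifting) distr_cong sets_density sets_lborel)
    have std: "distributed ?P lborel (\<lambda>f. f b) std_normal_density" if "b \<in> Basis" for b :: 'a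
      using comp[OF that] that unfolding distributed_def
      by (auto cong: distr_cong)
    have [measurable]: "(\<lambda>f. f b) \<in> borel_measurable ?P" if "b \<in> Basis" for b :: 'a
      using std[OF that] by (auto dest: distributed_measurable)
    have "distr ?P (\<Pi>\<^sub>M b\<in>(Basis :: 'a set). borel) (\<lambda>f. \<lambda>b\<in>Basis. f b) = distr ?P ?P (\<lambda>f. f)"
      by (intro distr_cong sets_PiM_cong) (auto simp: space_PiM PiE_restrict)
    then have "P.indep_vars (\<lambda>_. borel) (\<lambda>b f. f b) (Basis :: 'a set)"
      by (subst P.indep_vars_iff_distr_eq_PiM') (auto simp: comp cong: PiM_cong)
    then have "distr ?P borel (\<lambda>f. (\<Sum>b\<in>S. (f b)\<^sup>2) / (\<Sum>b\<in>Basis. (f b)\<^sup>2))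
      = beta_distribution (card S / 2) (card (Basis - S) / 2)"
      using S False by (intro P.distr_square_ratio std) auto
    also have "distr ?P borel (\<lambda>f. (\<Sum>b\<in>S. (f b)\<^sup>2) / (\<Sum>b\<in>Basis. (f b)\<^sup>2))
      = distr std_gaussian borel (\<lambda>x. (\<Sum>b\<in>S. (x \<bullet> b)\<^sup>2) / (norm x)\<^sup>2)"
      using S unfolding std_gaussian_def norm
      by (subst distr_distr) (auto intro!: distr_cong sum.cong arg_cong2[where f = "(/)"] simp: o_def inner_sum_left_Basis subset_iff)
    finally show ?thesis .
  qed
qed

subsection \<open>The orthogonal QR factor of a Gaussian matrix\<close>

lemma pos_less: "i < j \<Longrightarrow> pos i < pos (j::'n::{finite,linorder})"
  unfolding pos_def by (rule psubset_card_mono) auto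

lemma inj_pos: "inj (pos :: 'n::{finite,linorder} \<Rightarrow> nat)"
  by (rule injI) (metis linorder_neqE nat_less_le pos_less)

lemma range_pos: "range (pos :: 'n::{finite,linorder} \<Rightarrow> nat) = {..<CARD('n)}"
proof (rule card_subset_eq)
  have "pos i < CARD('n)" for i :: 'n
    unfolding pos_def by (rule psubset_card_mono) auto
  then show "range (pos :: 'n \<Rightarrow> nat) \<subseteq> {..<CARD('n)}" by auto
qed (simp_all add: card_image inj_pos)

lemma orthogonal_matrix_columns:
  assumes "orthogonal_matrix (A :: real ^ 'n ^ 'n)"
  shows "(\<Sum>m\<in>UNIV. A $ m $ i * A $ m $ j) = (if i = j then 1 else 0)"
proof -
  have "(transpose A ** A) $ i $ j = (mat 1 :: real ^ 'n ^ 'n) $ i $ j"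
    using assms by (simp add: orthogonal_matrix)
  then show ?thesis by (simp add: matrix_matrix_mult_def transpose_def mat_def)
qed

text \<open>Induction over columns. Once the earlier columns of \<open>A\<close> are unit vectors,
  the equation for \<open>S\<close> collapses on and below the diagonal to
  \<open>A $ i $ j * R $ j $ j = S $ i $ j\<close>, which kills the entries below it. Orthogonality
  to the earlier columns kills those above it, and unit length with positivity forces the diagonal
  entry to be 1.\<close>

lemma orthogonal_triangular_eq_1:
  fixes A R S :: "real ^ 'd::{finite,linorder} ^ 'd::{finite,linorder}"
  assumes A: "orthogonal_matrix A" and eq: "A ** R = S"
    and R: "\<And>i j. j < i \<Longrightarrow> R $ i $ j = 0" "\<And>i. 0 < R $ i $ i"
    and S: "\<And>i j. j < i \<Longrightarrow> S $ i $ j = 0" "\<And>i. 0 < S $ i $ i"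
  shows "A = mat 1"
proof -
  have "A $ i $ j = (if i = j then 1 else 0)" for i j
  proof (induction j arbitrary: i rule: measure_induct_rule[where f = pos])
    case (less j)
    have IH: "A $ i $ k = (if i = k then 1 else 0)" if "k < j" for i k
      using less pos_less[OF that] by blast
    have entry: "A $ i $ j * R $ j $ j = S $ i $ j" if "\<not> i < j" for i
    proof -
      have "S $ i $ j = (\<Sum>k\<in>UNIV. A $ i $ k * R $ k $ j)"
        by (simp add: matrix_matrix_mult_def flip: eq)
      also have "\<dots> = (\<Sum>k\<in>UNIV. if k = j then A $ i $ j * R $ j $ j else 0)"
      proof (rule sum.cong)
        fix k
        show "A $ i $ k * R $ k $ j = (if k = j then A $ i $ j * R $ j $ j else 0)"
          using that R(1)[of j k] IH[of k i] by (cases k j rule: linorder_cases) auto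
      qed simp
      finally show ?thesis by simp
    qed
    have below: "A $ i $ j = 0" if "j < i" for i
      using entry[of i] S(1)[OF that] R(2)[of j] that by simp
    have above: "A $ i $ j = 0" if "i < j" for i
    proof -
      have "0 = (\<Sum>m\<in>UNIV. A $ m $ i * A $ m $ j)"
        using orthogonal_matrix_columns[OF A, of i j] that by simp
      also have "\<dots> = (\<Sum>m\<in>UNIV. if m = i then A $ i $ j else 0)"
        by (rule sum.cong) (auto simp: IH[OF that])
      finally show ?thesis by simp
    qed
    have off: "A $ i $ j = 0" if "i \<noteq> j" for i
      using that above below by (cases i j rule: linorder_cases) auto
    have "1 = (\<Sum>m\<in>UNIV. A $ m $ j * A $ m $ j)"
      using orthogonal_matrix_columns[OF A, of j j] by simp
    also have "\<dots> = (\<Sum>m\<in>UNIV. if m = j then A $ j $ j * A $ j $ j else 0)"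
      by (rule sum.cong) (auto simp: off)
    finally have "(A $ j $ j)\<^sup>2 = 1" by (simp add: power2_eq_square)
    moreover have "0 < A $ j $ j"
      using entry[of j] S(2)[of j] R(2)[of j] by (metis less_irrefl zero_less_mult_pos2)
    ultimately have "A $ j $ j = 1" by (simp add: power2_eq_1_iff)
    then show ?case using off by auto
  qed
  then show ?thesis by (simp add: vec_eq_iff mat_def)
qed

text \<open>The orthogonal matrix \<open>transpose Q' ** Q\<close> carries \<open>R\<close> to
  \<open>R'\<close>, both upper triangular with positive diagonal, so it is the identity.\<close>

lemma is_QR_unique:
  assumes "is_QR Z Q R" "is_QR Z Q' R'"
  shows "Q = Q'"
proof -
  have orth: "orthogonal_matrix Q" "orthogonal_matrix Q'" and eq: "Q ** R = Q' ** R'"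
    using assms by (auto simp: is_QR_def)
  have "(transpose Q' ** Q) ** R = transpose Q' ** (Q' ** R')"
    by (simp add: eq flip: matrix_mul_assoc)
  also have "\<dots> = R'"
    using orth by (simp add: matrix_mul_assoc orthogonal_matrix)
  finally have "transpose Q' ** Q = mat 1"
    using assms orth
    by (intro orthogonal_triangular_eq_1[of _ R R']) (auto simp: is_QR_def orthogonal_matrix_mul)
  then have "Q' ** (transpose Q' ** Q) = Q'" by simp
  then show ?thesis
    using orth by (simp add: matrix_mul_assoc orthogonal_matrix_def)
qed

text \<open>Eliminates the quantified \<open>R\<close>, which can only be
  \<open>transpose Q ** Z\<close>. What remains are conditions on entries that are continuous in
  \<open>Q\<close> and \<open>Z\<close>, as the measurability argument requires.\<close>

lemma is_QR_iff:
  "(\<exists>R. is_QR Z Q R) \<longleftrightarrow> orthogonal_matrix Q \<and>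
    (\<forall>i j. j < i \<longrightarrow> (transpose Q ** Z) $ i $ j = 0) \<and> (\<forall>i. 0 < (transpose Q ** Z) $ i $ i)"
proof
  assume "\<exists>R. is_QR Z Q R"
  then obtain R where R: "is_QR Z Q R" ..
  then have "transpose Q ** Z = R"
    by (auto simp: is_QR_def matrix_mul_assoc orthogonal_matrix)
  then show "orthogonal_matrix Q \<and>
    (\<forall>i j. j < i \<longrightarrow> (transpose Q ** Z) $ i $ j = 0) \<and> (\<forall>i. 0 < (transpose Q ** Z) $ i $ i)"
    using R by (simp add: is_QR_def)
next
  assume *: "orthogonal_matrix Q \<and>
    (\<forall>i j. j < i \<longrightarrow> (transpose Q ** Z) $ i $ j = 0) \<and> (\<forall>i. 0 < (transpose Q ** Z) $ i $ i)"
  then have "Z = Q ** (transpose Q ** Z)"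
    by (simp add: matrix_mul_assoc orthogonal_matrix_def)
  with * show "\<exists>R. is_QR Z Q R" unfolding is_QR_def by blast
qed

section \<open>Measurability of the QR factor\<close>

lemma compact_orthogonal_matrices: "compact {A :: real ^ 'n ^ 'n. orthogonal_matrix A}"
proof (rule compact_eq_bounded_closed[THEN iffD2, OF conjI])
  have "norm A \<le> (\<Sum>i\<in>(UNIV::'n set). 1)" if A: "orthogonal_matrix A" for A :: "real ^ 'n ^ 'n"
  proof -
    have "norm A \<le> (\<Sum>i\<in>UNIV. norm (A $ i))" unfolding norm_vec_def by (rule L2_set_le_sum) simp
    also have "\<dots> = (\<Sum>i\<in>(UNIV::'n set). 1)"
      using A by (intro sum.cong) (auto simp: orthogonal_matrix_orthonormal_rows row_def)
    finally show ?thesis .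
  qed
  then show "bounded {A :: real ^ 'n ^ 'n. orthogonal_matrix A}"
    unfolding bounded_iff by blast
  have "closed {A :: real ^ 'n ^ 'n. transpose A ** A = mat 1}"
    unfolding matrix_matrix_mult_def transpose_def by (intro closed_Collect_eq continuous_intros)
  then show "closed {A :: real ^ 'n ^ 'n. orthogonal_matrix A}"
    by (simp add: orthogonal_matrix)
qed

text \<open>
  The set is a countable union, over the lower bounds \<open>1 / Suc n\<close> on the diagonal of the
  triangular factor, of projections of closed sets along the compact orthogonal group.
\<close>

lemma sets_QR_factor_in:
  fixes C :: "(real ^ 'd::{finite,linorder} ^ 'd::{finite,linorder}) set"
  assumes C: "closed C"
  shows "{Z. \<exists>Q\<in>C. \<exists>R. is_QR Z Q R} \<in> sets borel"
proof -
  define T where "T n = {p :: (real ^ 'd::{finite,linorder} ^ 'd::{finite,linorder}) \<times> (real ^ 'd::{finite,linorder} ^ 'd::{finite,linorder}).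
    (\<forall>i j. j < i \<longrightarrow> (transpose (fst p) ** snd p) $ i $ j = 0) \<and>
    (\<forall>i. 1 / Suc n \<le> (transpose (fst p) ** snd p) $ i $ i)}" for n :: nat
  have "closed (T n)" for n
  proof -
    have cont: "continuous_on UNIV (\<lambda>p :: (real ^ 'd::{finite,linorder} ^ 'd::{finite,linorder}) \<times> (real ^ 'd::{finite,linorder} ^ 'd::{finite,linorder}). (transpose (fst p) ** snd p) $ i $ j)" for i j
      unfolding matrix_matrix_mult_def transpose_def by (simp, intro continuous_intros)
    show ?thesis
      unfolding T_def
      by (intro closed_Collect_conj closed_Collect_all closed_Collect_imp closed_Collect_eq
        closed_Collect_le cont continuous_on_const) auto
  qed
  then have "closed {Z. \<exists>Q. Q \<in> C \<inter> {A. orthogonal_matrix A} \<and> (Q, Z) \<in> T n}" for n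
    using C by (intro closed_compact_projection closed_Int_compact compact_orthogonal_matrices)
  then have "(\<Union>n. {Z. \<exists>Q. Q \<in> C \<inter> {A. orthogonal_matrix A} \<and> (Q, Z) \<in> T n}) \<in> sets borel"
    by (intro sets.countable_UN) auto
  also have "(\<Union>n. {Z. \<exists>Q. Q \<in> C \<inter> {A. orthogonal_matrix A} \<and> (Q, Z) \<in> T n}) = {Z. \<exists>Q\<in>C. \<exists>R. is_QR Z Q R}"
  proof -
    have pos: "(\<exists>n. \<forall>i. 1 / Suc n \<le> f i) \<longleftrightarrow> (\<forall>i. 0 < f i)" for f :: "'d \<Rightarrow> real"
    proof
      assume "\<exists>n. \<forall>i. 1 / Suc n \<le> f i"
      then obtain n where "\<And>i. 1 / Suc n \<le> f i" by blast
      moreover have "0 < 1 / real (Suc n)" by simp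
      ultimately show "\<forall>i. 0 < f i" by (meson less_le_trans)
    next
      assume "\<forall>i. 0 < f i"
      then have "0 < Min (range f)" by (subst Min_gr_iff) auto
      then obtain n where "1 / Suc n < Min (range f)" by (metis nat_approx_posE)
      then show "\<exists>n. \<forall>i. 1 / Suc n \<le> f i" by (intro exI[of _ n]) (auto dest: less_imp_le)
    qed
    have "Z \<in> (\<Union>n. {Z. \<exists>Q. Q \<in> C \<inter> {A. orthogonal_matrix A} \<and> (Q, Z) \<in> T n}) \<longleftrightarrow>
      (\<exists>Q\<in>C. orthogonal_matrix Q \<and> (\<forall>i j. j < i \<longrightarrow> (transpose Q ** Z) $ i $ j = 0) \<and>
        (\<exists>n. \<forall>i. 1 / Suc n \<le> (transpose Q ** Z) $ i $ i))" for Z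
      unfolding T_def by (simp only: UN_iff mem_Collect_eq Int_iff fst_conv snd_conv) blast
    then show ?thesis
      unfolding pos is_QR_iff by blast
  qed
  finally show ?thesis .
qed

text \<open>The value 0 is a default that makes the map total on matrices without a
  decomposition.\<close>

definition QR_factor :: "real ^ 'd::{finite,linorder} ^ 'd::{finite,linorder} \<Rightarrow> real ^ 'd::{finite,linorder} ^ 'd::{finite,linorder}" where
  "QR_factor Z = (if \<exists>Q R. is_QR Z Q R then THE Q. \<exists>R. is_QR Z Q R else 0)"

lemma QR_factor_eq: "is_QR Z Q R \<Longrightarrow> QR_factor Z = Q"
  unfolding QR_factor_def by (auto intro!: the_equality dest: is_QR_unique)

lemma borel_measurable_QR_factor [measurable]:
  "(QR_factor :: real ^ 'd::{finite,linorder} ^ 'd::{finite,linorder} \<Rightarrow> _) \<in> borel_measurable borel"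
proof (rule borel_measurableI)
  fix S :: "(real ^ 'd::{finite,linorder} ^ 'd::{finite,linorder}) set" assume "open S"
  then have [measurable]: "{Z. \<exists>Q\<in>-S. \<exists>R. is_QR Z Q R} \<in> sets borel"
    by (intro sets_QR_factor_in) (simp add: closed_def)
  have [measurable]: "{Z :: real ^ 'd::{finite,linorder} ^ 'd::{finite,linorder}. \<exists>Q\<in>UNIV. \<exists>R. is_QR Z Q R} \<in> sets borel"
    by (intro sets_QR_factor_in) simp
  \<comment> \<open>By uniqueness, having some factor in the closed set \<open>-S\<close> means that
    the factor lies outside \<open>S\<close>. Matrices without a decomposition take the default 0,
    so they belong to the preimage exactly when \<open>0 \<in> S\<close>.\<close>
  have "QR_factor -` S \<inter> space borel = (if 0 \<in> S then - {Z. \<exists>Q\<in>-S. \<exists>R. is_QR Z Q R}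
      else {Z. \<exists>Q\<in>UNIV. \<exists>R. is_QR Z Q R} - {Z. \<exists>Q\<in>-S. \<exists>R. is_QR Z Q R})"
  proof -
    have "QR_factor Z \<in> S \<longleftrightarrow> \<not> (\<exists>Q\<in>-S. \<exists>R. is_QR Z Q R)" if "is_QR Z Q R" for Z Q R
      using QR_factor_eq that by fastforce
    moreover have "QR_factor Z = 0" if "\<nexists>Q R. is_QR Z Q R" for Z :: "real ^ 'd::{finite,linorder} ^ 'd::{finite,linorder}"
      using that by (simp add: QR_factor_def)
    ultimately show ?thesis by (auto split: if_splits) metis+
  qed
  also have "\<dots> \<in> sets borel"
    by (cases "0 \<in> S"; simp only: if_True if_False; measurable)
  finally show "QR_factor -` S \<inter> space borel \<in> sets borel" .
qed

text \<open>The inner product of matrices is the sum of the inner products of their columns, and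
  left multiplication by \<open>U\<close> acts on each column as an isometry.\<close>

lemma orthogonal_transformation_matrix_mult:
  fixes U :: "real ^ 'n ^ 'n"
  assumes U: "orthogonal_matrix U"
  shows "orthogonal_transformation (\<lambda>Z :: real ^ 'n ^ 'n. U ** Z)"
  unfolding orthogonal_transformation_def
proof (intro conjI allI)
  show "linear (\<lambda>Z :: real ^ 'n ^ 'n. U ** Z)"
    by (rule linearI) (simp_all add: matrix_add_ldistrib matrix_scalar_ac scalar_matrix_assoc flip: scalar_mult_eq_scaleR)
  have inner: "A \<bullet> B = (\<Sum>j\<in>UNIV. column j A \<bullet> column j B)" for A B :: "real ^ 'n ^ 'n"
    unfolding inner_vec_def column_def by (simp, rule sum.swap)
  have col: "column j (U ** A) = U *v column j A" for j and A :: "real ^ 'n ^ 'n"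
    by (simp add: column_def matrix_matrix_mult_def matrix_vector_mult_def vec_eq_iff)
  have "orthogonal_transformation ((*v) U)"
    using U by (simp add: orthogonal_transformation_matrix)
  then have "(U *v x) \<bullet> (U *v y) = x \<bullet> y" for x y
    by (simp add: orthogonal_transformation_def)
  then show "(U ** A) \<bullet> (U ** B) = A \<bullet> B" for A B :: "real ^ 'n ^ 'n"
    by (simp add: inner col)
qed

lemma (in prob_space) distr_iid_std_normal_matrix:
  fixes Z :: "'a \<Rightarrow> real ^ 'd ^ 'd"
  assumes "iid_std_normal_matrix M Z"
  shows "distr M borel Z = std_gaussian" "Z \<in> borel_measurable M"
proof -
  have ind: "indep_vars (\<lambda>_. borel) (\<lambda>(i, j) \<omega>. Z \<omega> $ i $ j) UNIV"
    and std: "\<And>i j. distributed M lborel (\<lambda>\<omega>. Z \<omega> $ i $ j) std_normal_density"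
    using assms by (auto simp: iid_std_normal_matrix_def)
  have ex: "\<forall>b\<in>(Basis :: (real ^ 'd ^ 'd) set). \<exists>p. b = axis (fst p) (axis (snd p) 1)"
    by (auto simp: Basis_vec_def)
  from bchoice[OF ex] obtain f where f: "\<forall>b\<in>Basis. (b :: real ^ 'd ^ 'd) = axis (fst (f b)) (axis (snd (f b)) 1)"
    ..
  have comp: "x \<bullet> b = x $ fst (f b) $ snd (f b)" if "b \<in> Basis" for x b :: "real ^ 'd ^ 'd"
  proof -
    have "x \<bullet> axis i (axis j 1) = x $ i $ j" for i j
      by (simp add: inner_axis)
    then show ?thesis using f that by metis
  qed
  have "inj_on f Basis" by (rule inj_onI) (metis f)
  let ?X = "\<lambda>p \<omega>. Z \<omega> $ fst p $ snd p"
  \<comment> \<open>Independence is moved from index pairs to basis matrices: \<open>f b\<close> is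
    the position of the entry 1 of \<open>b\<close>, and the singleton blocks \<open>{f b}\<close>
    are disjoint because \<open>f\<close> is injective.\<close>
  have "indep_vars (\<lambda>b. \<Pi>\<^sub>M p\<in>{f b}. borel) (\<lambda>b \<omega>. restrict (\<lambda>p. ?X p \<omega>) {f b}) Basis"
    using ind \<open>inj_on f Basis\<close>
    by (intro indep_vars_restrict[where I = UNIV])
       (auto simp: case_prod_unfold disjoint_family_on_def inj_on_def)
  then have "indep_vars (\<lambda>_. borel) (\<lambda>b \<omega>. (\<lambda>g. g (f b)) (restrict (\<lambda>p. ?X p \<omega>) {f b})) Basis"
    by (rule indep_vars_compose2) (simp add: measurable_component_singleton)
  then have "indep_vars (\<lambda>_. borel) (\<lambda>b \<omega>. Z \<omega> \<bullet> b) Basis"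
    by (rule indep_vars_cong[THEN iffD1, rotated -1]) (simp_all add: comp)
  then show "distr M borel Z = std_gaussian"
    by (rule distr_std_gaussian) (simp add: comp std)
  show "Z \<in> borel_measurable M"
    using distributed_measurable[OF std]
    by (subst borel_measurable_euclidean_space) (simp add: comp)
qed

lemma borel_measurable_matrix_mult_left [measurable]:
  "(\<lambda>Z :: real ^ 'n ^ 'n. U ** Z) \<in> borel_measurable borel"
  unfolding matrix_matrix_mult_def
  by (intro borel_measurable_continuous_onI continuous_intros)

lemma (in prob_space) gaussian_QR_factor_haar:
  assumes "gaussian_QR_factor M Q"
  shows "haar_orthogonal M Q"
proof -
  obtain Z where Q [measurable]: "Q \<in> borel_measurable M" and Z: "iid_std_normal_matrix M Z"
    and QR: "AE \<omega> in M. \<exists>R. is_QR (Z \<omega>) (Q \<omega>) R"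
    using assms unfolding gaussian_QR_factor_def by blast
  note [measurable] = distr_iid_std_normal_matrix(2)[OF Z]
  \<comment> \<open>The right side does not mention \<open>U\<close>, so comparing an arbitrary
    \<open>U\<close> with the identity yields invariance. The triangular factor of
    \<open>U ** Z\<close> is that of \<open>Z\<close>.\<close>
  have law: "distr M borel (\<lambda>\<omega>. U ** Q \<omega>) = distr std_gaussian borel QR_factor"
    if U: "orthogonal_matrix U" for U
  proof -
    have "AE \<omega> in M. U ** Q \<omega> = QR_factor (U ** Z \<omega>)"
      using QR
    proof eventually_elim
      case (elim \<omega>)
      then obtain R where R: "is_QR (Z \<omega>) (Q \<omega>) R" ..
      then have "is_QR (U ** Z \<omega>) (U ** Q \<omega>) R"
        using U by (auto simp: is_QR_def matrix_mul_assoc orthogonal_matrix_mul)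
      then show ?case by (rule QR_factor_eq[symmetric])
    qed
    then have "distr M borel (\<lambda>\<omega>. U ** Q \<omega>) = distr M borel (\<lambda>\<omega>. QR_factor (U ** Z \<omega>))"
      by (intro distr_cong_AE) auto
    also have "\<dots> = distr (distr (distr M borel Z) borel (\<lambda>A. U ** A)) borel QR_factor"
      by (simp add: distr_distr o_def)
    also have "\<dots> = distr std_gaussian borel QR_factor"
      by (simp add: distr_iid_std_normal_matrix(1)[OF Z] std_gaussian_distr_orthogonal_transformation
        orthogonal_transformation_matrix_mult[OF U])
    finally show ?thesis .
  qed
  show ?thesis
    unfolding haar_orthogonal_def
  proof (intro conjI allI impI)
    show "AE \<omega> in M. orthogonal_matrix (Q \<omega>)"
      using QR by eventually_elim (auto simp: is_QR_def)
    show "distr M borel (\<lambda>\<omega>. U ** Q \<omega>) = distr M borel Q" if "orthogonal_matrix U" for U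
      using law[OF that] law[OF orthogonal_matrix_id] by simp
  qed simp
qed

subsection \<open>Random projections\<close>

text \<open>
  For \<open>g\<close> standard Gaussian and independent of \<open>Q\<close>, the vector \<open>Q\<^sup>T g\<close> is again standard
  Gaussian given \<open>Q\<close>; given \<open>g\<close>, left invariance replaces \<open>g\<close> by the multiple of \<open>v\<close> that has
  the same norm.
\<close>

lemma (in prob_space) distr_haar_orthogonal_vector:
  fixes Q :: "'a \<Rightarrow> real ^ 'd ^ 'd" and v :: "real ^ 'd" and h :: "real ^ 'd \<Rightarrow> real"
  assumes haar: "haar_orthogonal M Q" and v: "v \<noteq> 0"
    and h [measurable]: "h \<in> borel_measurable borel"
    and scale: "\<And>c x. 0 < c \<Longrightarrow> h (c *\<^sub>R x) = h x"
  shows "distr M borel (\<lambda>\<omega>. h (transpose (Q \<omega>) *v v)) = distr std_gaussian borel h"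
proof (rule measure_eqI)
  fix A assume "A \<in> sets (distr M borel (\<lambda>\<omega>. h (transpose (Q \<omega>) *v v)))"
  then have [measurable]: "A \<in> sets borel" by simp
  have [measurable]: "Q \<in> borel_measurable M" and orth: "AE \<omega> in M. orthogonal_matrix (Q \<omega>)"
    and inv: "\<And>U. orthogonal_matrix U \<Longrightarrow> distr M borel (\<lambda>\<omega>. U ** Q \<omega>) = distr M borel Q"
    using haar by (auto simp: haar_orthogonal_def)
  interpret G: prob_space "std_gaussian :: (real ^ 'd) measure" by (rule prob_space_std_gaussian)
  interpret MG: pair_prob_space M "std_gaussian :: (real ^ 'd) measure" ..
  have Tm: "(\<lambda>p. transpose (fst p) *v snd p) \<in> borel_measurable (borel \<Otimes>\<^sub>M borel :: ((real ^ 'd ^ 'd) \<times> (real ^ 'd)) measure)"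
    unfolding borel_prod matrix_vector_mult_def transpose_def
    by (intro borel_measurable_continuous_onI) (simp, intro continuous_intros)
  have meas: "(\<lambda>x. transpose (f x) *v g x) \<in> borel_measurable N"
    if "f \<in> borel_measurable N" "g \<in> borel_measurable N"
    for f :: "'c \<Rightarrow> real ^ 'd ^ 'd" and g N
    using measurable_compose[OF measurable_Pair[OF that] Tm] by (simp only: fst_conv snd_conv)
  have Qv [measurable]: "(\<lambda>\<omega>. transpose (Q \<omega>) *v w) \<in> borel_measurable M" for w
    by (rule meas) auto
  note Qv[simplified, measurable]
  have same: "(\<integral>\<^sup>+\<omega>. indicator A (h (transpose (Q \<omega>) *v g)) \<partial>M)
      = emeasure (distr M borel (\<lambda>\<omega>. h (transpose (Q \<omega>) *v v))) A" (is "_ = ?p") if "g \<noteq> 0" for g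
  proof -
    \<comment> \<open>With this \<open>c\<close> the vectors \<open>c *\<^sub>R v\<close> and
      \<open>g\<close> have equal norm, so an orthogonal \<open>U\<close> takes one to the other.
      Then \<open>U\<close> is absorbed by left invariance of \<open>Q\<close> and \<open>c\<close>
      by the scale invariance of \<open>h\<close>.\<close>
    define c where "c = norm g / norm v"
    have c: "c > 0" using that v by (simp add: c_def)
    have "norm (c *\<^sub>R v) = norm g" using v by (simp add: c_def)
    then obtain f where f: "orthogonal_transformation f" "f (c *\<^sub>R v) = g"
      by (rule orthogonal_transformation_exists)
    define U where "U = matrix f"
    have U: "orthogonal_matrix U" "g = U *v (c *\<^sub>R v)"
      using f by (auto simp: U_def orthogonal_transformation_matrix)
    have eq: "transpose (Q \<omega>) *v g = c *\<^sub>R (transpose (transpose U ** Q \<omega>) *v v)" for \<omega>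
      by (simp add: U(2) matrix_transpose_mul matrix_vector_mul_assoc matrix_vector_mult_scaleR)
    have m: "(\<lambda>B. h (transpose B *v v)) \<in> borel_measurable borel"
      by (intro measurable_compose[OF meas h]) auto
    have "(\<integral>\<^sup>+\<omega>. indicator A (h (transpose (Q \<omega>) *v g)) \<partial>M)
      = (\<integral>\<^sup>+\<omega>. indicator A (h (transpose (transpose U ** Q \<omega>) *v v)) \<partial>M)"
      by (simp only: eq scale[OF c])
    also have "\<dots> = (\<integral>\<^sup>+B. indicator A (h (transpose B *v v)) \<partial>distr M borel (\<lambda>\<omega>. transpose U ** Q \<omega>))"
      using m by (subst nn_integral_distr) auto
    also have "\<dots> = (\<integral>\<^sup>+B. indicator A (h (transpose B *v v)) \<partial>distr M borel Q)"
      using U by (subst inv) auto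
    also have "\<dots> = (\<integral>\<^sup>+\<omega>. indicator A (h (transpose (Q \<omega>) *v v)) \<partial>M)"
      using m by (subst nn_integral_distr) auto
    also have "\<dots> = (\<integral>\<^sup>+x. indicator A x \<partial>distr M borel (\<lambda>\<omega>. h (transpose (Q \<omega>) *v v)))"
      by (subst nn_integral_distr) auto
    finally show ?thesis by simp
  qed
  \<comment> \<open>A constant is averaged over \<open>g\<close>, so that exchanging the integrals
    lets the Gaussian be rotated by each fixed \<open>Q \<omega>\<close>.\<close>
  have "?p = (\<integral>\<^sup>+g. ?p \<partial>(std_gaussian :: (real ^ 'd) measure))"
    using G.emeasure_space_1 by simp
  also have "\<dots> = (\<integral>\<^sup>+g. (\<integral>\<^sup>+\<omega>. indicator A (h (transpose (Q \<omega>) *v g)) \<partial>M) \<partial>std_gaussian)"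
    by (rule nn_integral_cong_AE, use AE_std_gaussian_nonzero in eventually_elim) (rule same[symmetric])
  also have "\<dots> = (\<integral>\<^sup>+\<omega>. (\<integral>\<^sup>+g. indicator A (h (transpose (Q \<omega>) *v g)) \<partial>std_gaussian) \<partial>M)"
  proof (rule MG.Fubini')
    have [measurable]: "(\<lambda>x. transpose (Q (fst x)) *v snd x) \<in> borel_measurable (M \<Otimes>\<^sub>M std_gaussian)"
      by (rule meas) measurable
    show "(\<lambda>(\<omega>, g). indicator A (h (transpose (Q \<omega>) *v g)) :: ennreal) \<in> borel_measurable (M \<Otimes>\<^sub>M std_gaussian)"
      unfolding case_prod_beta' by measurable
  qed
  also have "\<dots> = (\<integral>\<^sup>+\<omega>. emeasure (distr std_gaussian borel h) A \<partial>M)"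
  proof (rule nn_integral_cong_AE, use orth in eventually_elim)
    fix \<omega> assume "orthogonal_matrix (Q \<omega>)"
    then have T: "orthogonal_transformation ((*v) (transpose (Q \<omega>)))"
      by (simp add: orthogonal_transformation_matrix)
    have [measurable]: "(*v) (transpose (Q \<omega>)) \<in> borel_measurable borel"
      by (intro borel_measurable_continuous_onI continuous_intros)
    have "(\<integral>\<^sup>+g. indicator A (h (transpose (Q \<omega>) *v g)) \<partial>std_gaussian)
      = (\<integral>\<^sup>+g. indicator A (h g) \<partial>distr std_gaussian borel ((*v) (transpose (Q \<omega>))))"
      by (subst nn_integral_distr) auto
    also have "\<dots> = (\<integral>\<^sup>+x. indicator A x \<partial>distr std_gaussian borel h)"
      unfolding std_gaussian_distr_orthogonal_transformation[OF T]
      by (subst nn_integral_distr) auto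
    finally show "(\<integral>\<^sup>+g. indicator A (h (transpose (Q \<omega>) *v g)) \<partial>std_gaussian)
      = emeasure (distr std_gaussian borel h) A" by simp
  qed
  also have "\<dots> = emeasure (distr std_gaussian borel h) A"
    by (simp add: emeasure_space_1)
  finally show "?p = emeasure (distr std_gaussian borel h) A" .
qed simp

text \<open>\<open>S\<close> consists of the indices whose positions occur in \<open>'l\<close>, the
  first \<ell> of them; later only its cardinality matters. It is chosen before \<open>Q\<close> and
  \<open>v\<close>, so one function of \<open>Q\<^sup>T v\<close> serves all outcomes.\<close>

lemma norm_transpose_embedding_matrix:
  assumes "CARD('l) \<le> CARD('d)"
  shows "\<exists>S :: 'd::{finite,linorder} set. card S = CARD('l::{finite,linorder}) \<and>
    (\<forall>(Q :: real ^ 'd::{finite,linorder} ^ 'd::{finite,linorder}) v.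
      (norm (transpose (embedding_matrix Q :: real ^ 'l::{finite,linorder} ^ 'd::{finite,linorder}) *v v))\<^sup>2
        = real CARD('d) / real CARD('l) * (\<Sum>k\<in>S. ((transpose Q *v v) $ k)\<^sup>2))"
proof -
  have "\<exists>k :: 'd. pos k = pos (j :: 'l)" for j
  proof -
    have "pos j < CARD('l)" using range_pos[where 'n = 'l] by blast
    then have "pos j \<in> range (pos :: 'd \<Rightarrow> nat)" using assms by (simp add: range_pos)
    then show ?thesis by force
  qed
  then obtain \<kappa> :: "'l \<Rightarrow> 'd" where \<kappa>: "\<And>j. pos (\<kappa> j) = pos j" by metis
  have inj: "inj \<kappa>" using \<kappa> inj_pos by (metis injD injI)
  have pos_eq: "pos k = pos j \<longleftrightarrow> k = \<kappa> j" for k j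
    using \<kappa> inj_pos by (metis injD)
  show ?thesis
  proof (intro exI[of _ "range \<kappa>"] conjI allI)
    show "card (range \<kappa>) = CARD('l)" using inj by (rule card_image)
    fix Q :: "real ^ 'd::{finite,linorder} ^ 'd::{finite,linorder}" and v :: "real ^ 'd::{finite,linorder}"
    let ?c = "real CARD('d) / real CARD('l)"
    have entry: "(embedding_matrix Q :: real ^ 'l::{finite,linorder} ^ 'd::{finite,linorder}) $ i $ j = sqrt ?c * Q $ i $ \<kappa> j" for i j
      by (simp add: embedding_matrix_def first_columns_def matrix_matrix_mult_def pos_eq
        if_distrib[of "(*) _"] cong: if_cong)
    have "(transpose (embedding_matrix Q :: real ^ 'l::{finite,linorder} ^ 'd::{finite,linorder}) *v v) $ j = sqrt ?c * (transpose Q *v v) $ \<kappa> j" for j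
      unfolding matrix_vector_mult_def transpose_def by (simp add: entry sum_distrib_left mult.assoc)
    then have "(norm (transpose (embedding_matrix Q :: real ^ 'l::{finite,linorder} ^ 'd::{finite,linorder}) *v v))\<^sup>2
      = (\<Sum>j\<in>UNIV. (sqrt ?c * (transpose Q *v v) $ \<kappa> j)\<^sup>2)"
      unfolding power2_norm_eq_inner inner_vec_def by (simp only: inner_real_def power2_eq_square)
    also have "\<dots> = ?c * (\<Sum>j\<in>UNIV. ((transpose Q *v v) $ \<kappa> j)\<^sup>2)"
      by (simp only: power_mult_distrib sum_distrib_left) simp
    also have "(\<Sum>j\<in>UNIV. ((transpose Q *v v) $ \<kappa> j)\<^sup>2) = (\<Sum>k\<in>range \<kappa>. ((transpose Q *v v) $ k)\<^sup>2)"
      by (simp only: sum.reindex[OF inj] o_def)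
    finally show "(norm (transpose (embedding_matrix Q :: real ^ 'l::{finite,linorder} ^ 'd::{finite,linorder}) *v v))\<^sup>2
      = ?c * (\<Sum>k\<in>range \<kappa>. ((transpose Q *v v) $ k)\<^sup>2)" .
  qed
qed

lemma distr_std_gaussian_cart_ratio:
  fixes S :: "'n::finite set"
  assumes "S \<noteq> {}"
  shows "distr std_gaussian borel (\<lambda>x :: real ^ 'n. (\<Sum>k\<in>S. (x $ k)\<^sup>2) / (norm x)\<^sup>2)
    = beta_distribution (card S / 2) ((real CARD('n) - card S) / 2)"
proof -
  let ?e = "\<lambda>k :: 'n. axis k (1 :: real)"
  have inj: "inj ?e" by (rule injI) (simp add: axis_eq_axis)
  have Basis: "range ?e = Basis" by (auto simp: Basis_vec_def)
  have "card (Basis - ?e ` S) = CARD('n) - card S"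
    unfolding Basis[symmetric] by (simp add: card_Diff_subset card_image inj inj_on_subset[OF inj] image_mono)
  moreover have "card S \<le> CARD('n)" by (simp add: card_mono)
  moreover have "card (?e ` S) = card S" by (simp add: card_image inj_on_subset[OF inj])
  moreover have "(\<Sum>b\<in>?e ` S. (x \<bullet> b)\<^sup>2) = (\<Sum>k\<in>S. (x $ k)\<^sup>2)" for x :: "real ^ 'n"
    by (simp add: sum.reindex inj_on_subset[OF inj] inner_axis)
  ultimately show ?thesis
    using distr_std_gaussian_square_ratio[of "?e ` S"] assms Basis by (auto simp: of_nat_diff)
qed

text \<open>The distribution function measures \<open>{..p}\<close>, so the closed half-lines
  complement each other only if \<open>p\<close> carries no mass. For \<open>b > 0\<close> there is
  a density; for \<open>b = 0\<close> the only atom is 1, and \<open>p < 1\<close>.\<close>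

lemma measure_beta_distribution_atLeast:
  assumes prob: "prob_space (beta_distribution a b)" and ab: "0 < a" "0 \<le> b" and p: "p < 1"
  shows "measure (beta_distribution a b) {p..} = 1 - reg_inc_beta p a b"
proof -
  interpret B: prob_space "beta_distribution a b" by (rule prob)
  have sets: "sets (beta_distribution a b) = sets borel" by (simp add: beta_distribution_def)
  have space: "space (beta_distribution a b) = UNIV" by (simp add: beta_distribution_def)
  have "emeasure (beta_distribution a b) {p} = 0"
  proof (cases "b = 0")
    case True
    then show ?thesis using p by (simp add: beta_distribution_def)
  next
    case False
    then have "emeasure (beta_distribution a b) {p}
        = (\<integral>\<^sup>+x. ennreal (beta_density a b x) * indicator {p} x \<partial>lborel)"
      using ab by (subst beta_distribution_density) (simp_all add: emeasure_density)
    also have "\<dots> = 0"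
      by (subst nn_integral_0_iff_AE) (use AE_lborel_singleton[of p] in \<open>auto simp: indicator_def elim: eventually_mono\<close>)
    finally show ?thesis .
  qed
  then have null: "measure (beta_distribution a b) {p} = 0" by (simp add: measure_def)
  have "{p..} = {p} \<union> {p<..}" by auto
  then have "measure (beta_distribution a b) {p..} = measure (beta_distribution a b) {p<..}"
    using B.finite_measure_Union[of "{p}" "{p<..}"] null sets by simp
  also have "{p<..} = space (beta_distribution a b) - {..p}" using space by auto
  also have "measure (beta_distribution a b) \<dots> = 1 - measure (beta_distribution a b) {..p}"
    using sets by (intro B.prob_compl) simp
  finally show ?thesis by (simp add: reg_inc_beta_def cdf_def)
qed

theorem lemma1:
  fixes \<epsilon> :: real
    and v :: "real ^ 'd::{finite,linorder}"
    and M :: "'a measure" and Q :: "'a \<Rightarrow> real ^ 'd::{finite,linorder} ^ 'd::{finite,linorder}"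
    and P :: "'a \<Rightarrow> real ^ 'l::{finite,linorder} ^ 'd::{finite,linorder}"
    and N :: "'b measure" and X :: "'b \<Rightarrow> real"
    and d l \<delta> :: real
  defines "d \<equiv> real CARD('d)" and "l \<equiv> real CARD('l)"
    and "P \<equiv> \<lambda>\<omega>. embedding_matrix (Q \<omega>)"
    and "\<delta> \<equiv> \<P>(\<omega> in M. (norm (transpose (P \<omega>) *v v))\<^sup>2 \<ge> (1 - \<epsilon>) * (norm v)\<^sup>2)"
  assumes "0 < \<epsilon>" "\<epsilon> < 1"
    and "CARD('l) \<le> CARD('d)"
    and "v \<noteq> 0"
    and "prob_space M"
    and "haar_orthogonal M Q \<or> gaussian_QR_factor M Q"
    and "prob_space N" "X \<in> borel_measurable N"
    and "distr N borel X = beta_distribution (l / 2) ((d - l) / 2)"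
  shows "\<delta> = 1 - reg_inc_beta ((1 - \<epsilon>) * l / d) (l / 2) ((d - l) / 2) \<and>
         1 - reg_inc_beta ((1 - \<epsilon>) * l / d) (l / 2) ((d - l) / 2)
           = \<P>(x in N. X x \<ge> (1 - \<epsilon>) * l / d)"
proof -
  interpret M: prob_space M by fact
  interpret N: prob_space N by fact
  let ?p = "(1 - \<epsilon>) * l / d" and ?B = "beta_distribution (l / 2) ((d - l) / 2)"
  have dl: "0 < l" "l \<le> d" "0 < d"
    using \<open>CARD('l) \<le> CARD('d)\<close> by (simp_all add: d_def l_def)
  have haar: "haar_orthogonal M Q"
    using \<open>haar_orthogonal M Q \<or> gaussian_QR_factor M Q\<close> M.gaussian_QR_factor_haar by blast
  have [measurable]: "Q \<in> borel_measurable M" and orth: "AE \<omega> in M. orthogonal_matrix (Q \<omega>)"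
    using haar by (auto simp: haar_orthogonal_def)
  have [measurable]: "X \<in> borel_measurable N" by fact
  obtain S :: "'d set" where S: "card S = CARD('l)"
    and P: "\<And>Q v. (norm (transpose (embedding_matrix Q :: real ^ 'l::{finite,linorder} ^ 'd::{finite,linorder}) *v v))\<^sup>2
      = d / l * (\<Sum>k\<in>S. ((transpose Q *v v) $ k)\<^sup>2)"
    using norm_transpose_embedding_matrix[OF \<open>CARD('l) \<le> CARD('d)\<close>] unfolding d_def l_def by metis
  have "S \<noteq> {}" using S by auto
  define h where "h x = (\<Sum>k\<in>S. (x $ k)\<^sup>2) / (norm x)\<^sup>2" for x :: "real ^ 'd::{finite,linorder}"
  have [measurable]: "h \<in> borel_measurable borel"
    unfolding h_def by measurable
  have "continuous_on UNIV (\<lambda>A :: real ^ 'd::{finite,linorder} ^ 'd::{finite,linorder}. transpose A *v v)"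
    unfolding matrix_vector_mult_def transpose_def by (simp, intro continuous_intros)
  then have Qv: "(\<lambda>\<omega>. transpose (Q \<omega>) *v v) \<in> borel_measurable M"
    by (intro measurable_compose[OF \<open>Q \<in> borel_measurable M\<close>] borel_measurable_continuous_onI)
  note Qv[measurable] Qv[simplified, measurable]
  have hQ [measurable]: "(\<lambda>\<omega>. h (transpose (Q \<omega>) *v v)) \<in> borel_measurable M"
    by measurable
  have law: "distr M borel (\<lambda>\<omega>. h (transpose (Q \<omega>) *v v)) = ?B"
  proof -
    have "h (c *\<^sub>R x) = h x" if "0 < c" for c x
      using that by (simp add: h_def power_mult_distrib flip: sum_distrib_left)
    then have "distr M borel (\<lambda>\<omega>. h (transpose (Q \<omega>) *v v)) = distr std_gaussian borel h"
      using haar \<open>v \<noteq> 0\<close> by (intro M.distr_haar_orthogonal_vector) auto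
    then show ?thesis
      using distr_std_gaussian_cart_ratio[OF \<open>S \<noteq> {}\<close>] S by (simp add: h_def[abs_def] d_def l_def)
  qed
  \<comment> \<open>Orthogonality of \<open>Q\<close> makes \<open>(norm v)\<^sup>2\<close> the
    denominator of \<open>h\<close>; moving the factor \<open>d / l\<close> to the other side
    produces the threshold \<open>?p\<close>.\<close>
  have "AE \<omega> in M. (1 - \<epsilon>) * (norm v)\<^sup>2 \<le> (norm (transpose (P \<omega>) *v v))\<^sup>2
      \<longleftrightarrow> ?p \<le> h (transpose (Q \<omega>) *v v)"
    using orth
  proof eventually_elim
    fix \<omega> assume "orthogonal_matrix (Q \<omega>)"
    then have "orthogonal_transformation ((*v) (transpose (Q \<omega>)))"
      by (simp add: orthogonal_transformation_matrix)
    then have norm: "norm (transpose (Q \<omega>) *v v) = norm v"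
      by (rule orthogonal_transformation_norm)
    have "0 < (norm v)\<^sup>2" using \<open>v \<noteq> 0\<close> by simp
    then show "(1 - \<epsilon>) * (norm v)\<^sup>2 \<le> (norm (transpose (P \<omega>) *v v))\<^sup>2
      \<longleftrightarrow> ?p \<le> h (transpose (Q \<omega>) *v v)"
      using dl unfolding P_def P h_def norm by (simp add: field_simps)
  qed
  then have "\<delta> = \<P>(\<omega> in M. ?p \<le> h (transpose (Q \<omega>) *v v))"
    unfolding \<delta>_def
    by (intro M.finite_measure_eq_AE) (auto simp: P_def P[simplified])
  also have "\<dots> = measure ?B {?p..}"
    unfolding law[symmetric] using hQ by (subst measure_distr) (auto intro!: arg_cong[where f = "measure M"])
  finally have \<delta>: "\<delta> = measure ?B {?p..}" .
  have X: "\<P>(x in N. X x \<ge> ?p) = measure ?B {?p..}"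
    unfolding \<open>distr N borel X = ?B\<close>[symmetric]
    by (subst measure_distr) (auto intro!: arg_cong[where f = "measure N"])
  \<comment> \<open>Strictness, from \<open>0 < \<epsilon>\<close>, keeps the threshold off the atom
    at 1 when \<ell> = d.\<close>
  have "?p < 1"
  proof -
    have "(1 - \<epsilon>) * l < 1 * d" using dl \<open>0 < \<epsilon>\<close> \<open>\<epsilon> < 1\<close> by (intro mult_less_le_imp_less) auto
    then show ?thesis using dl by simp
  qed
  \<comment> \<open>Total mass 1 is inherited from the law of \<open>X\<close>, uniformly for the
    density and the point mass.\<close>
  moreover have "prob_space ?B"
    unfolding \<open>distr N borel X = ?B\<close>[symmetric] by (rule N.prob_space_distr) simp
  ultimately have "measure ?B {?p..} = 1 - reg_inc_beta ?p (l / 2) ((d - l) / 2)"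
    using dl by (intro measure_beta_distribution_atLeast) auto
  then show ?thesis using \<delta> X by simp
qed

end
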